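(* Let $L : M_n(\mathbb{R}) \to M_n(\mathbb{R})$ be a linear map. Then $L$ is an onto preserver of Schur stability (that is, $L(\mathcal{S}) = \mathcal{S}$, where $\mathcal{S} \subseteq M_n(\mathbb{R})$ is the set of Schur stable matrices) if and only if there exist an invertible matrix $T \in M_n(\mathbb{R})$ and $c \in \mathbb{R}$ with $|c| = 1$ such that either $L(A) = c\, T A T^{-1}$ for all $A \in M_n(\mathbb{R})$, or $L(A) = c\, T A^t T^{-1}$ for all $A \in M_n(\mathbb{R})$.
   Context: $M_n(\mathbb{R})$ is the real vector space of $n \times n$ real matrices. A matrix $A \in M_n(\mathbb{R})$ is Schur stable if all its (complex) eigenvalues lie in the open unit disc. $A^t$ denotes the transpose of $A$. *)

theory Defs
  imports "HOL-Analysis.Analysis"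
begin

definition mat_eigenvalue :: "'a::field ^ 'n ^ 'n \<Rightarrow> 'a \<Rightarrow> bool" where
  "mat_eigenvalue A k \<longleftrightarrow> (\<exists>v. v \<noteq> 0 \<and> A *v v = k *s v)"

definition schur_stable :: "real ^ 'n ^ 'n \<Rightarrow> bool" where
  "schur_stable A \<longleftrightarrow>
     (\<forall>k. mat_eigenvalue (map_matrix complex_of_real A) k \<longrightarrow> cmod k < 1)"

definition onto_preserver_schur :: "(real ^ 'n ^ 'n \<Rightarrow> real ^ 'n ^ 'n) \<Rightarrow> bool" where
  "onto_preserver_schur L \<longleftrightarrow> L ` {A. schur_stable A} = {A. schur_stable A}"

end

(* A linear map that maps the Schur stable matrices onto themselves is bijective and, by homogeneity,
   preserves the spectral radius rho.  It maps I to c I with |c| = 1, because a non-scalar Z has a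
   square-zero Q with tr (Z Q) nonzero, and then rho (Z + t Q) is unbounded in t while
   rho (I + t N) = 1 for every nilpotent N.  So assume L I = I; then tr (L A) = tr A, since L
   maps square-zero matrices to nilpotent ones.

   Let R be a rank one idempotent.  The eigenvalues of A + t R are bounded except for one, which is
   t + tr (A R) + O(1/t).  Preservation of rho for A + t R + s I, s real, and of the trace forces
   L A + t L R to have one eigenvalue of modulus at most t + tr (A R) + O(1/t), all others being
   O(sqrt t).  Comparing the traces of the third and fourth powers of L A + t L R as t grows gives
   tr (L A (L R)^2) = tr (L A (L R)^3) = tr (A R) for all A, so (L R)^2 is an idempotent of trace 1.
   Hence the inverse adjoint of L maps rank one idempotents to rank one idempotents, which forces it,
   and therefore L, to be a conjugation, possibly composed with the transpose. *)
theory Submission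
  imports "Jordan_Normal_Form.Schur_Decomposition" "HOL-Real_Asymp.Real_Asymp" Defs
begin

text \<open>Stability controls only the largest modulus, so nothing is known directly about the
  other eigenvalues of an image. The shifts by real multiples of I make up for this: every disc with
  real centre that contains the spectrum of X also contains that of L X, and in a disc with diameter
  close to [0, t] a bounded real part forces modulus O(sqrt t). This size dictates the powers.
  Eigenvalues of order sqrt t contribute order t to the trace of the square, as much as the term
  sought; they contribute t^(3/2) against t^2 for the cube, and t^2 against t^3 for the fourth
  power. Each comparison yields only an inequality, but both sides are linear in A. Having two
  powers identifies (L R)^2 with (L R)^3, and idempotency of (L R)^2 follows. In terms of B = L A
  the functional A -> tr (A R) reads B -> tr (B (L R)^2), which is why the inverse adjoint, rather
  than L, is the map first shown to preserve rank one idempotents.\<close>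

section \<open>Triangularization and eigenvalues\<close>

hide_const (open) Matrix.vec_index Determinant.det Matrix.scalar_prod Matrix.vec Matrix.row Matrix.col Matrix.mat List.transpose
no_notation Matrix.vec_index (infixl \<open>$\<close> 100)
no_notation Matrix.scalar_prod (infix \<open>\<bullet>\<close> 70)

text \<open>Products carry over along a numbering \<open>r\<close> of the index type, so a Schur
  decomposition of a matrix indexed by naturals can be read back on
  \<open>complex ^ 'n ^ 'n\<close>.\<close>

lemma from_mat_mult:
  fixes M N :: "'a::comm_ring_1 Matrix.mat" and r :: "'n::finite \<Rightarrow> nat"
  assumes r: "bij_betw r UNIV {..<n}" and M: "M \<in> carrier_mat n n" and N: "N \<in> carrier_mat n n"
  shows "(\<chi> i j. (M * N) $$ (r i, r j)) = (\<chi> i j. M $$ (r i, r j)) ** (\<chi> i j. N $$ (r i, r j))"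
proof -
  have lt: "r i < n" for i using r by (auto simp: bij_betw_def)
  have "(M * N) $$ (r i, r j) = (\<Sum>k\<in>UNIV. M $$ (r i, r k) * N $$ (r k, r j))" for i j
  proof -
    have "(M * N) $$ (r i, r j) = (\<Sum>k\<in>{..<n}. M $$ (r i, k) * N $$ (k, r j))"
      using M N lt by (simp add: Matrix.scalar_prod_def atLeast0LessThan)
    also have "\<dots> = (\<Sum>k\<in>UNIV. M $$ (r i, r k) * N $$ (r k, r j))"
      by (rule sum.reindex_bij_betw[OF r, symmetric])
    finally show ?thesis .
  qed
  then show ?thesis by (simp add: matrix_matrix_mult_def)
qed

text \<open>The index type carries no order, so triangularity is meant relative to an injective
  numbering \<open>r\<close> of the indices.\<close>

lemma schur_triangularization:
  fixes A :: "complex ^ 'n ^ 'n"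
  obtains P Q B :: "complex ^ 'n ^ 'n" and r :: "'n \<Rightarrow> nat"
  where "inj r" "P ** Q = mat 1" "Q ** P = mat 1" "A = P ** B ** Q" "\<And>i j. r j < r i \<Longrightarrow> B $ i $ j = 0"
proof -
  define n where "n = CARD('n)"
  obtain h :: "nat \<Rightarrow> 'n" where h: "bij_betw h {0..<n} UNIV"
    using ex_bij_betw_nat_finite[of "UNIV::'n set"] by (auto simp: n_def)
  define r where "r = the_inv_into {0..<n} h"
  have r: "bij_betw r UNIV {..<n}"
    using bij_betw_the_inv_into[OF h] by (simp add: r_def atLeast0LessThan)
  have lt: "r i < n" for i using r by (auto simp: bij_betw_def)
  have hr: "h (r i) = i" for i
    unfolding r_def using h by (intro f_the_inv_into_f) (auto simp: bij_betw_def)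
  have inj: "inj r" using r by (simp add: bij_betw_def)
  define M where "M = Matrix.mat n n (\<lambda>(i,j). A $ h i $ h j)"
  have M: "M \<in> carrier_mat n n" by (simp add: M_def)
  obtain es where "char_poly M = (\<Prod>a\<leftarrow>es. [:- a, 1:])" using char_poly_factorized[OF M] by blast
  from schur_decomposition_exists[OF M this] obtain B P Q
    where ut: "upper_triangular B" and sim: "similar_mat_wit M B P Q"
    by (auto simp: similar_mat_def)
  note w = similar_mat_witD2[OF M sim]
  let ?f = "\<lambda>M::complex Matrix.mat. (\<chi> i j. M $$ (r i, r j)) :: complex^'n^'n"
  have one: "?f (1\<^sub>m n) = mat 1"
    using lt inj by (auto simp: vec_eq_iff mat_def inj_eq)
  have "?f P ** ?f Q = mat 1" using from_mat_mult[OF r w(6,7)] one w(1) by simp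
  moreover have "?f Q ** ?f P = mat 1" using from_mat_mult[OF r w(7,6)] one w(2) by simp
  moreover have "?f M = A" using lt by (simp add: vec_eq_iff M_def hr)
  then have "A = ?f P ** ?f B ** ?f Q"
    using from_mat_mult[OF r mult_carrier_mat[OF w(6,5)] w(7)] from_mat_mult[OF r w(6,5)] w(3) by simp
  moreover have "r j < r i \<Longrightarrow> ?f B $ i $ j = 0" for i j
    using ut lt w(5) by (auto simp: upper_triangular_def)
  ultimately show ?thesis using that inj by blast
qed

lemma upper_triangular_mult:
  fixes X Y :: "'a::comm_ring_1 ^ 'n ^ 'n" and r :: "'n \<Rightarrow> nat"
  assumes r: "inj r" and X: "\<And>i j. r j < r i \<Longrightarrow> X $ i $ j = 0"
    and Y: "\<And>i j. r j < r i \<Longrightarrow> Y $ i $ j = 0"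
  shows "r j < r i \<Longrightarrow> (X ** Y) $ i $ j = 0" "(X ** Y) $ i $ i = X $ i $ i * Y $ i $ i"
proof -
  have z: "X $ i $ k * Y $ k $ j = 0" if "r k < r i \<or> r j < r k" for i j k
    using that X Y by auto
  show "(X ** Y) $ i $ j = 0" if "r j < r i"
    unfolding matrix_matrix_mult_def using that by (auto intro!: sum.neutral z)
  have "(X ** Y) $ i $ i = (\<Sum>k\<in>UNIV. if k = i then X $ i $ i * Y $ i $ i else 0)"
  proof -
    have "X $ i $ k * Y $ k $ i = 0" if "k \<noteq> i" for k
    proof -
      have "r k \<noteq> r i" using r that by (auto simp: inj_eq)
      then show ?thesis by (intro z) auto
    qed
    then have "(\<Sum>k\<in>UNIV. X $ i $ k * Y $ k $ i) = (\<Sum>k\<in>UNIV. if k = i then X $ i $ i * Y $ i $ i else 0)"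
      by (intro sum.cong) auto
    then show ?thesis by (simp add: matrix_matrix_mult_def)
  qed
  then show "(X ** Y) $ i $ i = X $ i $ i * Y $ i $ i" by simp
qed

lemma det_upper_triangular_inj:
  fixes X :: "'a::comm_ring_1 ^ 'n ^ 'n" and r :: "'n \<Rightarrow> nat"
  assumes r: "inj r" and X: "\<And>i j. r j < r i \<Longrightarrow> X $ i $ j = 0"
  shows "det X = (\<Prod>i\<in>UNIV. X $ i $ i)"
proof -
  have z: "(\<Prod>i\<in>UNIV. X $ i $ p i) = 0" if p: "p permutes UNIV" "p \<noteq> id" for p
  proof -
    \<comment> \<open>A permutation preserves the sum of \<open>r\<close>; if it never lowers
      \<open>r\<close>, it fixes all values of \<open>r\<close> and is the identity.\<close>
    have "\<exists>i. r (p i) < r i"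
    proof (rule ccontr)
      assume "\<not> ?thesis"
      then have ge: "r i \<le> r (p i)" for i by (simp add: not_less)
      have eq: "(\<Sum>i\<in>UNIV. r (p i)) = (\<Sum>i\<in>UNIV. r i)"
        using sum.permute[OF p(1), of r] by (simp add: o_def)
      have "r (p i) = r i" for i
      proof (rule ccontr)
        assume "r (p i) \<noteq> r i"
        with ge[of i] have "r i < r (p i)" by simp
        then have "(\<Sum>i\<in>UNIV. r i) < (\<Sum>i\<in>UNIV. r (p i))"
          by (intro sum_strict_mono_ex1) (use ge in auto)
        with eq show False by simp
      qed
      then have "p = id" using r by (auto simp: inj_eq)
      with p(2) show False ..
    qed
    then obtain i where "r (p i) < r i" ..
    then show ?thesis using X by (intro prod_zero) auto
  qed
  have "det X = (\<Sum>p\<in>{p. p permutes (UNIV::'n set)}. if p = id then (\<Prod>i\<in>UNIV. X $ i $ i) else 0)"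
    unfolding det_def by (rule sum.cong) (auto simp: z)
  then show ?thesis by (simp add: permutes_id)
qed

lemma mat_eigenvalue_det:
  fixes A :: "'a::field ^ 'n ^ 'n"
  shows "mat_eigenvalue A k \<longleftrightarrow> det (A - mat k) = 0"
proof -
  have k: "mat k *v v = k *s v" for v :: "'a^'n"
    by (simp add: vec_eq_iff matrix_vector_mult_def mat_def if_distrib[of "\<lambda>x. x * _"] cong: if_cong)
  have "det (A - mat k) \<noteq> 0 \<longleftrightarrow> (\<forall>v. (A - mat k) *v v = 0 \<longrightarrow> v = 0)"
    unfolding invertible_det_nz[symmetric] invertible_left_inverse matrix_left_invertible_ker ..
  then show ?thesis
    by (auto simp: mat_eigenvalue_def matrix_vector_mult_diff_rdistrib k)
qed

lemma mat_eigenvalue_transpose: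
  fixes A :: "'a::field ^ 'n ^ 'n"
  shows "mat_eigenvalue (transpose A) k \<longleftrightarrow> mat_eigenvalue A k"
proof -
  have "transpose A - mat k = transpose (A - mat k)"
    by (simp add: vec_eq_iff transpose_def mat_def)
  then show ?thesis by (simp add: mat_eigenvalue_det)
qed

lemma mat_eigenvalue_similar:
  fixes A P Q :: "'a::field ^ 'n ^ 'n"
  assumes PQ: "P ** Q = mat 1" and QP: "Q ** P = mat 1"
  shows "mat_eigenvalue (P ** A ** Q) k \<longleftrightarrow> mat_eigenvalue A k"
proof -
  have *: "mat_eigenvalue (P ** A ** Q) k" if QP: "Q ** P = mat 1" and "mat_eigenvalue A k"
    for A P Q :: "'a ^ 'n ^ 'n"
  proof -
    obtain v where v: "v \<noteq> 0" "A *v v = k *s v" using \<open>mat_eigenvalue A k\<close> by (auto simp: mat_eigenvalue_def)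
    have "P *v v \<noteq> 0"
      by (metis QP matrix_vector_mul_assoc matrix_vector_mul_lid v(1) vec.zero)
    moreover have "(P ** A ** Q) *v (P *v v) = k *s (P *v v)"
      by (metis QP matrix_vector_mul_assoc matrix_vector_mul_lid v(2) vec.scale)
    ultimately show ?thesis by (auto simp: mat_eigenvalue_def)
  qed
  have "Q ** (P ** A ** Q) ** P = A"
    by (metis QP matrix_mul_assoc matrix_mul_lid matrix_mul_rid)
  then show ?thesis using *[OF QP, of A] *[OF PQ, of "P ** A ** Q"] by auto
qed

abbreviation cmat :: "real ^ 'n ^ 'n \<Rightarrow> complex ^ 'n ^ 'n" where
  "cmat \<equiv> map_matrix complex_of_real"

abbreviation eigval :: "real ^ 'n ^ 'n \<Rightarrow> complex \<Rightarrow> bool" where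
  "eigval A \<equiv> mat_eigenvalue (cmat A)"

lemma cmat_mult: "cmat (A ** B) = cmat A ** cmat B"
  by (simp add: vec_eq_iff matrix_matrix_mult_def)

lemma cmat_add: "cmat (A + B) = cmat A + cmat B"
  by (simp add: vec_eq_iff)

lemma cmat_one: "cmat (mat 1) = mat 1"
  by (simp add: vec_eq_iff mat_def)

lemma cmat_transpose: "cmat (transpose A) = transpose (cmat A)"
  by (simp add: vec_eq_iff transpose_def)

lemma trace_cmat: "trace (cmat A) = of_real (trace A)"
  by (simp add: trace_def)

text \<open>The index type itself enumerates the spectrum with multiplicity, as the diagonal of a
  triangular form. The power sums come with the family so that one and the same \<open>e\<close>
  serves all later trace comparisons.\<close>

lemma eigval_family:
  fixes A :: "real ^ 'n ^ 'n"
  obtains e :: "'n \<Rightarrow> complex"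
  where "\<And>k. eigval A k \<longleftrightarrow> k \<in> range e"
    "of_real (trace A) = (\<Sum>i\<in>UNIV. e i)"
    "of_real (trace (A ** A)) = (\<Sum>i\<in>UNIV. e i ^ 2)"
    "of_real (trace (A ** A ** A)) = (\<Sum>i\<in>UNIV. e i ^ 3)"
    "of_real (trace (A ** A ** A ** A)) = (\<Sum>i\<in>UNIV. e i ^ 4)"
proof -
  obtain P Q B and r :: "'n \<Rightarrow> nat" where r: "inj r" and PQ: "P ** Q = mat 1" "Q ** P = mat 1"
    and A: "cmat A = P ** B ** Q" and B: "\<And>i j. r j < r i \<Longrightarrow> B $ i $ j = 0"
    using schur_triangularization[of "cmat A"] by metis
  define e where "e = (\<lambda>i. B $ i $ i)"
  have "eigval A k \<longleftrightarrow> k \<in> range e" for k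
  proof -
    have "eigval A k \<longleftrightarrow> det (B - mat k) = 0"
      by (simp only: A mat_eigenvalue_similar[OF PQ]) (simp add: mat_eigenvalue_det)
    also have "det (B - mat k) = (\<Prod>i\<in>UNIV. (B - mat k) $ i $ i)"
      by (intro det_upper_triangular_inj[OF r]) (auto simp: B mat_def)
    finally show ?thesis by (auto simp: e_def mat_def)
  qed
  moreover have conj: "(P ** M ** Q) ** (P ** N ** Q) = P ** (M ** N) ** Q" for M N
    by (metis PQ(2) matrix_mul_assoc matrix_mul_rid)
  have tr: "trace (P ** M ** Q) = trace M" for M
    by (metis PQ(2) trace_mul_sym matrix_mul_assoc matrix_mul_lid)
  note ut = upper_triangular_mult[OF r]
  have "of_real (trace A) = (\<Sum>i\<in>UNIV. e i)"
    unfolding trace_cmat[symmetric] A tr by (simp add: trace_def e_def)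
  moreover have "of_real (trace (A ** A)) = (\<Sum>i\<in>UNIV. e i ^ 2)"
    unfolding trace_cmat[symmetric] cmat_mult A conj tr
    by (simp add: trace_def e_def ut B power2_eq_square)
  moreover have "of_real (trace (A ** A ** A)) = (\<Sum>i\<in>UNIV. e i ^ 3)"
    unfolding trace_cmat[symmetric] cmat_mult A conj tr
    by (simp add: trace_def e_def ut B power3_eq_cube)
  moreover have "of_real (trace (A ** A ** A ** A)) = (\<Sum>i\<in>UNIV. e i ^ 4)"
    unfolding trace_cmat[symmetric] cmat_mult A conj tr
    by (simp add: trace_def e_def ut B power4_eq_xxxx)
  ultimately show ?thesis using that by blast
qed

lemma eigval_shift: "eigval (A + s *\<^sub>R mat 1) (k + of_real s) \<longleftrightarrow> eigval A k"
proof -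
  have "cmat (A + s *\<^sub>R mat 1) - mat (k + of_real s) = cmat A - mat k"
    by (simp add: vec_eq_iff mat_def)
  then show ?thesis by (simp add: mat_eigenvalue_det)
qed

lemma eigval_scale:
  fixes A :: "real ^ 'n ^ 'n"
  assumes "c \<noteq> 0"
  shows "eigval (c *\<^sub>R A) (of_real c * k) \<longleftrightarrow> eigval A k"
proof -
  define M where "M = cmat A - mat k"
  have "cmat (c *\<^sub>R A) - mat (of_real c * k) = (\<chi> i. of_real c *s M $ i)"
    by (simp add: vec_eq_iff mat_def algebra_simps M_def)
  moreover have "det (\<chi> i. of_real c *s M $ i) = of_real c ^ CARD('n) * det M"
    using det_rows_mul[of "\<lambda>_. of_real c" "\<lambda>i. M $ i"] by simp
  ultimately show ?thesis using assms by (simp add: mat_eigenvalue_det M_def)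
qed

lemma eigval_exists: "\<exists>k. eigval A k"
  using eigval_family[of A] by (metis rangeI)

section \<open>Linear maps preserving the spectral radius\<close>

lemma norm_smult_complex: "norm (k *s v) = cmod k * norm (v :: complex ^ 'n)"
  by (simp add: norm_vec_def L2_set_def norm_mult power_mult_distrib sum_distrib_left[symmetric] real_sqrt_mult)

lemma matrix_vector_mult_norm_bound:
  fixes M :: "complex ^ 'n ^ 'm"
  obtains C where "C > 0" "\<And>v. norm (M *v v) \<le> C * norm v"
proof -
  have "linear ((*v) M)"
    by (rule linearI)
      (simp_all add: vec_eq_iff matrix_vector_mult_def sum.distrib scaleR_sum_right distrib_left)
  from linear_bounded_pos[OF this] show ?thesis using that by (auto simp: mult.commute)
qed

lemma eigval_bounded:
  obtains C where "C > 0" "\<And>k. eigval A k \<Longrightarrow> cmod k \<le> C"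
proof -
  obtain C where C: "C > 0" "\<And>v. norm (cmat A *v v) \<le> C * norm v"
    using matrix_vector_mult_norm_bound by blast
  have "cmod k \<le> C" if "eigval A k" for k
  proof -
    from that[unfolded mat_eigenvalue_def] obtain v where v: "v \<noteq> 0" "cmat A *v v = k *s v" by blast
    with C(2)[of v] show ?thesis by (simp add: norm_smult_complex)
  qed
  with C(1) that show ?thesis by blast
qed

lemma eigval_square_zero:
  assumes "Q ** Q = 0" "eigval Q k"
  shows "k = 0"
proof -
  obtain v where v: "v \<noteq> 0" "cmat Q *v v = k *s v" using assms(2) by (auto simp: mat_eigenvalue_def)
  have "cmat Q ** cmat Q = 0" using assms(1) by (simp add: cmat_mult[symmetric] vec_eq_iff)
  then have "cmat Q *v (cmat Q *v v) = 0" by (simp add: matrix_vector_mul_assoc)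
  then have "(k * k) *s v = 0" by (simp add: v vec.scale)
  with v(1) show ?thesis by simp
qed

section \<open>The trace pairing and matrix units\<close>

lemma inner_matrix_trace: "(A :: real ^ 'n ^ 'n) \<bullet> B = trace (transpose A ** B)"
proof -
  have "A \<bullet> B = (\<Sum>i\<in>UNIV. \<Sum>j\<in>UNIV. A $ i $ j * B $ i $ j)" by (simp add: inner_vec_def)
  also have "\<dots> = (\<Sum>j\<in>UNIV. \<Sum>i\<in>UNIV. A $ i $ j * B $ i $ j)" by (rule sum.swap)
  finally show ?thesis by (simp add: trace_def matrix_matrix_mult_def transpose_def)
qed

definition munit :: "'n \<Rightarrow> 'n \<Rightarrow> real ^ 'n ^ 'n" where
  "munit i j = (\<chi> a b. if a = i \<and> b = j then 1 else 0)"

lemma munit_nth: "munit i j $ a $ b = (if a = i \<and> b = j then 1 else 0)"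
  by (simp add: munit_def)

lemma munit_mult: "munit i j ** munit k l = (if j = k then munit i l else 0)"
proof -
  have "(munit i j ** munit k l) $ a $ b = (\<Sum>c\<in>UNIV. if c = j then (if a = i \<and> j = k \<and> b = l then 1 else 0) else 0)" for a b
    unfolding matrix_matrix_mult_def vec_lambda_beta by (rule sum.cong) (auto simp: munit_nth)
  then show ?thesis by (auto simp: vec_eq_iff munit_nth)
qed

lemma trace_munit: "trace (Z ** munit i j) = Z $ j $ i"
proof -
  have "(Z ** munit i j) $ a $ a = (if a = j then Z $ a $ i else 0)" for a
    unfolding matrix_matrix_mult_def munit_nth by (simp add: if_distrib cong: if_cong)
  then show ?thesis by (simp add: trace_def)
qed

lemma matrix_sum_munit: "A = (\<Sum>i\<in>UNIV. \<Sum>j\<in>UNIV. A $ i $ j *\<^sub>R munit i j)"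
proof -
  have "(\<Sum>i\<in>UNIV. \<Sum>j\<in>UNIV. A $ i $ j *\<^sub>R munit i j) $ a $ b = A $ a $ b" for a b
  proof -
    have "(\<Sum>i\<in>UNIV. \<Sum>j\<in>UNIV. A $ i $ j *\<^sub>R munit i j) $ a $ b =
      (\<Sum>i\<in>UNIV. \<Sum>j\<in>UNIV. if j = b then (if i = a then A $ i $ j else 0) else 0)"
      unfolding sum_component by (intro sum.cong refl) (auto simp: munit_nth)
    then show ?thesis by simp
  qed
  then show ?thesis by (simp add: vec_eq_iff)
qed

lemma matrix_mult_bilinear:
  fixes A B C :: "real ^ 'n ^ 'n"
  shows "(A + B) ** C = A ** C + B ** C" "(A - B) ** C = A ** C - B ** C" "(c *\<^sub>R A) ** C = c *\<^sub>R (A ** C)"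
    "C ** (A + B) = C ** A + C ** B" "C ** (A - B) = C ** A - C ** B" "C ** (c *\<^sub>R A) = c *\<^sub>R (C ** A)"
    "0 ** A = 0" "A ** 0 = 0"
  by (simp_all add: vec_eq_iff matrix_matrix_mult_def sum.distrib sum_subtractf sum_distrib_left algebra_simps)

lemma trace_scaleR: "trace (c *\<^sub>R A) = c * trace (A :: real ^ 'n ^ 'n)"
  by (simp add: trace_def sum_distrib_left)

text \<open>Testing against E_ij kills the off-diagonal entries. Testing against (e_i - e_j)(e_i +
  e_j)^T, square-zero because the two vectors are orthogonal, equates the diagonal ones.\<close>

lemma scalar_if_trace_square_zero:
  fixes Z :: "real ^ 'n ^ 'n"
  assumes "\<And>Q. Q ** Q = 0 \<Longrightarrow> trace (Z ** Q) = 0"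
  obtains c where "Z = c *\<^sub>R mat 1"
proof -
  have off: "Z $ j $ i = 0" if "i \<noteq> j" for i j
    using assms[of "munit i j"] that by (simp add: munit_mult trace_munit)
  have diag: "Z $ i $ i = Z $ j $ j" if "i \<noteq> j" for i j
  proof -
    let ?Q = "munit i i - munit j j + munit i j - munit j i"
    have "?Q ** ?Q = 0" using that
      by (simp add: matrix_mult_bilinear munit_mult)
    then have "trace (Z ** ?Q) = 0" by (rule assms)
    then show ?thesis using that
      by (simp add: matrix_mult_bilinear trace_add trace_sub trace_munit off)
  qed
  define c where "c = Z $ undefined $ undefined"
  have diag': "Z $ i $ i = c" for i
    unfolding c_def by (cases "i = undefined") (auto dest: diag)
  have "Z = c *\<^sub>R mat 1"
    by (simp add: vec_eq_iff mat_def off diag')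
  with that show ?thesis by blast
qed

lemma trace_square_le:
  fixes A :: "real ^ 'n ^ 'n"
  assumes "\<And>k. eigval A k \<Longrightarrow> cmod k \<le> r"
  shows "\<bar>trace (A ** A)\<bar> \<le> real CARD('n) * r\<^sup>2"
proof -
  obtain e :: "'n \<Rightarrow> complex" where e: "\<And>k. eigval A k \<longleftrightarrow> k \<in> range e"
    "of_real (trace (A ** A)) = (\<Sum>i\<in>UNIV. e i ^ 2)" using eigval_family[of A] by metis
  have "cmod (\<Sum>i\<in>UNIV. e i ^ 2) \<le> (\<Sum>i\<in>(UNIV::'n set). r\<^sup>2)"
    by (rule sum_norm_le) (auto simp: norm_power e(1) assms intro!: power_mono)
  then show ?thesis by (simp add: e(2)[symmetric])
qed

text \<open>The two domination clauses express equality of spectral radii without naming a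
  maximum.\<close>

locale spectral_preserver =
  fixes L :: "real ^ 'n ^ 'n \<Rightarrow> real ^ 'n ^ 'n"
  assumes lin: "linear L" and onto: "surj L"
    and dom: "eigval (L A) k \<Longrightarrow> \<exists>m. eigval A m \<and> cmod k \<le> cmod m"
    and dom': "eigval A k \<Longrightarrow> \<exists>m. eigval (L A) m \<and> cmod k \<le> cmod m"
begin

lemma trace_square_zero:
  assumes "Q ** Q = 0"
  shows "trace (L Q) = 0"
proof -
  obtain e :: "'n \<Rightarrow> complex" where e: "\<And>k. eigval (L Q) k \<longleftrightarrow> k \<in> range e"
    "of_real (trace (L Q)) = (\<Sum>i\<in>UNIV. e i)" using eigval_family[of "L Q"] by metis
  have "e i = 0" for i
  proof -
    have "eigval (L Q) (e i)" by (simp add: e(1))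
    from dom[OF this] obtain m where m: "eigval Q m" "cmod (e i) \<le> cmod m" by auto
    have "m = 0" by (rule eigval_square_zero[OF assms m(1)])
    with m(2) show ?thesis by simp
  qed
  then show ?thesis using e(2) by simp
qed

lemma image_one:
  obtains c where "\<bar>c\<bar> = 1" "L (mat 1) = c *\<^sub>R mat 1"
proof -
  define Z where "Z = L (mat 1)"
  have one: "eigval (mat 1 :: real^'n^'n) k \<longleftrightarrow> k = 1" for k
    by (auto simp: mat_eigenvalue_def cmat_one vec_eq_iff intro!: exI[of _ "1"])
  have "trace (Z ** Q) = 0" if Q: "Q ** Q = 0" for Q
  proof (rule ccontr)
    assume nz: "trace (Z ** Q) \<noteq> 0"
    obtain Q0 where Q0: "L Q0 = Q" using surjD[OF onto, of Q] by (auto simp: eq_commute)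
    have nil: "k = 0" if "eigval Q0 k" for k
    proof -
      from dom'[OF that] obtain m where m: "eigval Q m" "cmod k \<le> cmod m" unfolding Q0 by auto
      have "m = 0" by (rule eigval_square_zero[OF Q m(1)])
      with m(2) show ?thesis by simp
    qed
    \<comment> \<open>\<open>Q0\<close> has only the eigenvalue 0, so I + t Q0 has only the
      eigenvalue 1, and its image Z + t Q has spectral radius at most 1.\<close>
    have bd: "cmod k \<le> 1" if k: "eigval (Z + t *\<^sub>R Q) k" and t: "t \<noteq> 0" for t k
    proof -
      have "L (mat 1 + t *\<^sub>R Q0) = Z + t *\<^sub>R Q"
        by (simp add: linear_add[OF lin] linear_scale[OF lin] Q0 Z_def)
      then have "eigval (L (mat 1 + t *\<^sub>R Q0)) k" using k by (simp only:)
      from dom[OF this] obtain m where m: "eigval (mat 1 + t *\<^sub>R Q0) m" "cmod k \<le> cmod m" by auto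
      have "eigval (t *\<^sub>R Q0) (m - 1)"
        using eigval_shift[of "t *\<^sub>R Q0" 1 "m - 1"] m(1) by (simp add: add.commute)
      then have "eigval Q0 ((m - 1) / of_real t)"
        using eigval_scale[OF t, of Q0 "(m - 1) / of_real t"] t by simp
      from nil[OF this] t have "m = 1" by simp
      with m(2) show ?thesis by simp
    qed
    define b where "b = trace (Z ** Q)"
    \<comment> \<open>As Q^2 = 0, the trace of (Z + t Q)^2 is affine in t, and its modulus is at
      most n. This t makes the linear part n + |tr (Z^2)| + 1, too large for the constant part to
      compensate.\<close>
    define t where "t = (real CARD('n) + \<bar>trace (Z ** Z)\<bar> + 1) / (2 * b)"
    have t: "t \<noteq> 0" 
    proof -
      have "real CARD('n) + \<bar>trace (Z ** Z)\<bar> + 1 > 0" by (simp add: add_nonneg_pos)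
      then show ?thesis unfolding t_def using nz by (simp add: b_def)
    qed
    have "\<bar>trace ((Z + t *\<^sub>R Q) ** (Z + t *\<^sub>R Q))\<bar> \<le> real CARD('n)"
      using trace_square_le[OF bd[OF _ t]] by simp
    moreover have "trace ((Z + t *\<^sub>R Q) ** (Z + t *\<^sub>R Q)) = trace (Z ** Z) + 2 * t * b"
      using trace_mul_sym[of Q Z]
      by (simp add: matrix_mult_bilinear trace_add trace_scaleR Q b_def)
    moreover have "2 * t * b = real CARD('n) + \<bar>trace (Z ** Z)\<bar> + 1"
      using nz by (simp add: t_def b_def)
    ultimately show False by linarith
  qed
  then obtain c where c: "Z = c *\<^sub>R mat 1" using scalar_if_trace_square_zero by metis
  have eig: "k = of_real c" if "eigval Z k" for k
  proof -
    have "c *\<^sub>R mat 1 = 0 + c *\<^sub>R (mat 1 :: real^'n^'n)" by simp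
    with that c have "eigval (0 + c *\<^sub>R (mat 1 :: real^'n^'n)) ((k - of_real c) + of_real c)" by simp
    then have "eigval (0 :: real^'n^'n) (k - of_real c)" by (simp only: eigval_shift)
    then have "k - of_real c = 0" using eigval_square_zero[of 0] matrix_mult_bilinear(7) by blast
    then show ?thesis by simp
  qed
  obtain k where k: "eigval Z k" using eigval_exists[of Z] by (elim exE)
  have "\<exists>m. eigval (mat 1 :: real^'n^'n) m \<and> cmod k \<le> cmod m" using dom[of "mat 1" k] k by (simp only: Z_def)
  then have "\<bar>c\<bar> \<le> 1" using eig[OF k] one by auto
  moreover have "\<exists>m. eigval Z m \<and> cmod 1 \<le> cmod m" using dom'[of "mat 1" 1] one by (simp only: Z_def)
  then obtain m where "eigval Z m" "1 \<le> cmod m" by auto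
  then have "\<bar>c\<bar> \<ge> 1" using eig[of m] by simp
  ultimately have "\<bar>c\<bar> = 1" by simp
  then show ?thesis using that[of c] c by (simp only: Z_def)
qed

end

section \<open>Rank one perturbations\<close>

definition outer :: "real ^ 'n \<Rightarrow> real ^ 'n \<Rightarrow> real ^ 'n ^ 'n" where
  "outer v f = (\<chi> i j. v $ i * f $ j)"

lemma outer_mult: "outer v f ** outer w g = (f \<bullet> w) *\<^sub>R outer v g"
  by (simp add: outer_def vec_eq_iff matrix_matrix_mult_def inner_vec_def sum_distrib_left sum_distrib_right mult_ac)

lemma trace_outer: "trace (outer v f) = f \<bullet> v"
  by (simp add: outer_def trace_def inner_vec_def mult_ac)

text \<open>A bootstrap: \<open>est\<close> gives |mu - t| <= t/2, hence |mu| >= t/2, hence |mu - t|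
  <= 4 c. This controls the last term of mu (mu - t - a) = (mu (mu - t) - t a) + a (t - mu), and
  division by |mu| >= t/2 produces the rate 1/t.\<close>

lemma perturbed_eigenvalue_estimate:
  fixes \<mu> a :: complex and c t :: real
  assumes c: "c \<ge> 1" and t: "t > 0" and a: "cmod a \<le> c" and \<mu>: "cmod \<mu> \<ge> 4 * c"
    and est: "cmod (\<mu> * (\<mu> - of_real t) - of_real t * a) \<le> 2 * c\<^sup>2 * t / cmod \<mu>"
  shows "cmod (\<mu> - of_real t - a) \<le> 16 * c\<^sup>2 / t"
proof -
  have pos: "cmod \<mu> > 0" using c \<mu> by linarith
  have "2 * c\<^sup>2 * t / cmod \<mu> \<le> 2 * c\<^sup>2 * t / (2 * c)"
    using c t \<mu> pos by (intro divide_left_mono mult_pos_pos) (auto simp del: zero_less_norm_iff)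
  also have "\<dots> = c * t" using c by (simp add: power2_eq_square)
  finally have e1: "2 * c\<^sup>2 * t / cmod \<mu> \<le> c * t" .
  have "cmod \<mu> * cmod (\<mu> - of_real t) = cmod ((\<mu> * (\<mu> - of_real t) - of_real t * a) + of_real t * a)"
    by (simp add: norm_mult)
  also have "\<dots> \<le> c * t + t * c"
    using est e1 t a by (intro order_trans[OF norm_triangle_ineq] add_mono) (auto simp: norm_mult)
  finally have e2: "cmod \<mu> * cmod (\<mu> - of_real t) \<le> 2 * c * t" by simp
  have "4 * c * cmod (\<mu> - of_real t) \<le> cmod \<mu> * cmod (\<mu> - of_real t)"
    using \<mu> by (intro mult_right_mono) auto
  with e2 have "c * (4 * cmod (\<mu> - of_real t)) \<le> c * (2 * t)" by simp
  then have "cmod (\<mu> - of_real t) \<le> t / 2" using c by simp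
  moreover have "t \<le> cmod \<mu> + cmod (\<mu> - of_real t)"
    using norm_triangle_ineq4[of \<mu> "\<mu> - of_real t"] t by simp
  ultimately have e3: "cmod \<mu> \<ge> t / 2" by simp
  have "t / 2 * cmod (\<mu> - of_real t) \<le> 2 * c * t"
    using mult_right_mono[OF e3, of "cmod (\<mu> - of_real t)"] e2 by simp
  then have e4: "cmod (\<mu> - of_real t) \<le> 4 * c" using t by (simp add: field_simps)
  have "cmod \<mu> * cmod (\<mu> - of_real t - a) =
      cmod ((\<mu> * (\<mu> - of_real t) - of_real t * a) + a * (of_real t - \<mu>))"
    by (simp add: norm_mult[symmetric] algebra_simps)
  also have "\<dots> \<le> 4 * c\<^sup>2 + c * (4 * c)"
  proof (intro order_trans[OF norm_triangle_ineq] add_mono)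
    have "2 * c\<^sup>2 * t / cmod \<mu> \<le> 2 * c\<^sup>2 * t / (t / 2)"
      using c t e3 pos by (intro divide_left_mono) auto
    also have "\<dots> = 4 * c\<^sup>2" using t by simp
    finally show "cmod (\<mu> * (\<mu> - of_real t) - of_real t * a) \<le> 4 * c\<^sup>2" using est by linarith
    show "cmod (a * (of_real t - \<mu>)) \<le> c * (4 * c)"
      using a e4 c by (simp add: norm_mult norm_minus_commute mult_mono)
  qed
  finally have "t / 2 * cmod (\<mu> - of_real t - a) \<le> 8 * c\<^sup>2"
    using mult_right_mono[OF e3, of "cmod (\<mu> - of_real t - a)"] by (simp add: power2_eq_square)
  then show ?thesis using t by (simp add: field_simps)
qed

text \<open>Apply the functional phi given by f to the eigenvector equation mu w = M w + t phi(w) v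
  and to its image under M. Eliminating phi(M w) leaves (mu (mu - t) - t a) phi(w) = phi(M^2 w), and
  the right side is controlled once |w| is bounded in terms of |phi(w)|.\<close>

lemma eigval_rank_one_perturbation:
  fixes A :: "real ^ 'n ^ 'n" and v f :: "real ^ 'n"
  assumes fv: "f \<bullet> v = 1"
  defines "a \<equiv> trace (A ** outer v f)"
  obtains C where "C \<ge> 1"
    "\<And>t \<mu>. t > 0 \<Longrightarrow> eigval (A + t *\<^sub>R outer v f) \<mu> \<Longrightarrow> cmod \<mu> \<le> C \<or> cmod (\<mu> - of_real (t + a)) \<le> C / t"
proof -
  define M where "M = cmat A"
  define cv where "cv = (\<chi> i. complex_of_real (v $ i))"
  define \<phi> where "\<phi> = (\<lambda>w::complex^'n. \<Sum>i\<in>UNIV. of_real (f $ i) * w $ i)"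
  have \<phi>_lin: "\<phi> (x + y) = \<phi> x + \<phi> y" "\<phi> (k *s x) = k * \<phi> x" for x y k
    by (simp_all add: \<phi>_def sum.distrib sum_distrib_left algebra_simps)
  have \<phi>v: "\<phi> cv = 1"
    using fv by (simp add: \<phi>_def cv_def inner_vec_def flip: of_real_mult of_real_sum)
  have "trace (A ** outer v f) = (\<Sum>i\<in>UNIV. \<Sum>j\<in>UNIV. A $ i $ j * (v $ j * f $ i))"
    by (simp add: trace_def matrix_matrix_mult_def outer_def)
  then have \<phi>Mv: "\<phi> (M *v cv) = of_real a"
    by (simp add: \<phi>_def cv_def M_def a_def matrix_vector_mult_def sum_distrib_left mult_ac)
  have R: "cmat (outer v f) *v w = \<phi> w *s cv" for w
    by (simp add: vec_eq_iff matrix_vector_mult_def outer_def \<phi>_def cv_def sum_distrib_left mult_ac)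
  obtain c1 where c1: "\<And>w. norm (M *v w) \<le> c1 * norm w"
    using matrix_vector_mult_norm_bound by blast
  have "linear (\<lambda>w. \<phi> (M *v (M *v w)))"
    by (rule linearI)
      (simp_all add: \<phi>_def matrix_vector_mult_def sum.distrib distrib_left flip: scaleR_sum_right)
  from linear_bounded_pos[OF this] obtain c2 where c2: "\<And>w. cmod (\<phi> (M *v (M *v w))) \<le> c2 * norm w" by blast
  define c where "c = 1 + \<bar>c1\<bar> + \<bar>c2\<bar> + norm cv + \<bar>a\<bar>"
  have c: "1 \<le> c" "c1 \<le> c" "c2 \<le> c" "norm cv \<le> c" "\<bar>a\<bar> \<le> c" by (simp_all add: c_def add_increasing add_increasing2)
  have "cmod \<mu> \<le> 16 * c\<^sup>2 \<or> cmod (\<mu> - of_real (t + a)) \<le> 16 * c\<^sup>2 / t"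
    if t: "t > 0" and ev: "eigval (A + t *\<^sub>R outer v f) \<mu>" for t \<mu>
  proof (cases "cmod \<mu> \<ge> 4 * c")
    case False
    have "4 * c \<le> 16 * c\<^sup>2" using c(1) by (simp add: power2_eq_square)
    with False show ?thesis by linarith
  next
    case True
    from ev[unfolded mat_eigenvalue_def] obtain w where w: "w \<noteq> 0" "cmat (A + t *\<^sub>R outer v f) *v w = \<mu> *s w" by blast
    have "cmat (t *\<^sub>R outer v f) *v w = of_real t *s (cmat (outer v f) *v w)"
      by (simp add: vec_eq_iff matrix_vector_mult_def sum_distrib_left mult_ac)
    then have eq: "\<mu> *s w = M *v w + (of_real t * \<phi> w) *s cv"
      using w(2) by (simp add: cmat_add matrix_vector_mult_add_rdistrib R M_def)
    have eq1: "\<mu> * \<phi> w = \<phi> (M *v w) + of_real t * \<phi> w"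
      using arg_cong[OF eq, of \<phi>] by (simp only: \<phi>_lin \<phi>v mult_1_right)
    have "M *v (\<mu> *s w) = M *v (M *v w) + M *v ((of_real t * \<phi> w) *s cv)"
      by (simp only: eq matrix_vector_right_distrib)
    then have "\<mu> *s (M *v w) = M *v (M *v w) + (of_real t * \<phi> w) *s (M *v cv)"
      by (simp only: vec.scale)
    from arg_cong[OF this, of \<phi>] have eq2: "\<mu> * \<phi> (M *v w) = \<phi> (M *v (M *v w)) + of_real t * \<phi> w * of_real a"
      by (simp only: \<phi>_lin \<phi>Mv)
    \<comment> \<open>Since |mu| >= 4 c, the term c |w| is absorbed by the left side, so |w| is at
      most 2 c t |phi(w)| / |mu|. In particular phi(w) is nonzero and may be cancelled.\<close>
    have "cmod \<mu> * norm w = norm (M *v w + (of_real t * \<phi> w) *s cv)"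
      using arg_cong[OF eq, of norm] by (simp only: norm_smult_complex)
    also have "\<dots> \<le> c * norm w + t * cmod (\<phi> w) * c"
    proof (intro order_trans[OF norm_triangle_ineq] add_mono)
      show "norm (M *v w) \<le> c * norm w" using c1[of w] c(2) by (smt (verit) mult_right_mono norm_ge_zero)
      show "norm ((of_real t * \<phi> w) *s cv) \<le> t * cmod (\<phi> w) * c"
        using t c(4) by (simp add: norm_smult_complex norm_mult mult_left_mono)
    qed
    also have "c * norm w \<le> cmod \<mu> * norm w / 2"
      using mult_right_mono[of "2 * c" "cmod \<mu>" "norm w"] True c(1) by simp
    finally have w2: "norm w * cmod \<mu> \<le> 2 * c * t * cmod (\<phi> w)" by (simp add: field_simps)
    have pos: "cmod \<mu> > 0" using True c(1) by linarith
    have \<phi>0: "\<phi> w \<noteq> 0"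
    proof
      assume "\<phi> w = 0"
      with w2 have "norm w * cmod \<mu> \<le> 0" by simp
      with pos w(1) show False by (simp add: mult_le_0_iff)
    qed
    have "(\<mu> * (\<mu> - of_real t) - of_real t * of_real a) * \<phi> w = \<phi> (M *v (M *v w))"
    proof -
      have "\<mu> * (\<mu> * \<phi> w) = \<mu> * \<phi> (M *v w) + \<mu> * (of_real t * \<phi> w)" by (simp only: eq1 distrib_left)
      then show ?thesis by (simp only: eq2) (simp add: algebra_simps)
    qed
    then have "cmod (\<mu> * (\<mu> - of_real t) - of_real t * of_real a) * cmod (\<phi> w) \<le> c2 * norm w"
      using c2[of w] by (simp add: norm_mult[symmetric])
    also have "\<dots> \<le> c * norm w" using c(3) by (simp add: mult_right_mono)
    also have "\<dots> \<le> c * (2 * c * t * cmod (\<phi> w) / cmod \<mu>)"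
      using w2 pos c(1) by (intro mult_left_mono) (auto simp: field_simps)
    also have "\<dots> = (2 * c\<^sup>2 * t / cmod \<mu>) * cmod (\<phi> w)" by (simp add: power2_eq_square)
    finally have "cmod (\<mu> * (\<mu> - of_real t) - of_real t * of_real a) \<le> 2 * c\<^sup>2 * t / cmod \<mu>"
      by (rule mult_right_le_imp_le) (use \<phi>0 in simp)
    from perturbed_eigenvalue_estimate[OF c(1) t _ True this] c(5) show ?thesis
      by (simp add: algebra_simps)
  qed
  moreover have "16 * c\<^sup>2 \<ge> 1" using one_le_power[OF c(1), of 2] by linarith
  ultimately show ?thesis using that by blast
qed

text \<open>Meant for real parts of eigenvalues: with a common lower bound, one term close to the
  whole sum leaves only a bounded amount for any other.\<close>

lemma sum_exceptional_le:
  fixes x :: "'n::finite \<Rightarrow> real"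
  assumes "\<And>i. x i \<ge> - C" "C \<ge> 0" "i \<noteq> i0"
  shows "x i0 + x i \<le> (\<Sum>j\<in>UNIV. x j) + real CARD('n) * C"
proof -
  have C: "0 \<le> x j + C" for j using assms(1)[of j] by simp
  have "(x i0 + C) + (x i + C) = (\<Sum>j\<in>{i0, i}. x j + C)" using assms(3) by simp
  also have "\<dots> \<le> (\<Sum>j\<in>UNIV. x j + C)" using C by (intro sum_mono2) auto
  also have "\<dots> = (\<Sum>j\<in>UNIV. x j) + real CARD('n) * C" by (simp add: sum.distrib)
  finally show ?thesis using assms(2) by simp
qed

text \<open>The numerator is the eigenvalue bound for the trace of a cube minus its expansion in t.
  The cubic terms cancel and the share t^(3/2) of the small eigenvalues is below t^2, so the limit
  compares the coefficients of t^2.\<close>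

lemma tendsto_cube_gap:
  fixes a b C c0 c1 c2 n :: real
  shows "((\<lambda>t. ((t + a + C / t) ^ 3 + n * t powr (3 / 2) - (t ^ 3 + 3 * t\<^sup>2 * b + t * c1 + c0)) / t\<^sup>2)
    \<longlongrightarrow> 3 * (a - b)) at_top"
  by real_asymp

lemma tendsto_fourth_gap:
  fixes a b C c0 c1 c2 n :: real
  shows "((\<lambda>t. ((t + a + C / t) ^ 4 + n * t\<^sup>2 - (t ^ 4 + 4 * t ^ 3 * b + t\<^sup>2 * c2 + t * c1 + c0)) / t ^ 3)
    \<longlongrightarrow> 4 * (a - b)) at_top"
  by real_asymp

section \<open>Locating the spectrum of the image of a perturbed matrix\<close>

context spectral_preserver
begin

text \<open>Adding s I moves the point from which moduli are measured to -s. The spectrum of L A is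
  thus confined to every disc about a real centre that contains the spectrum of A.\<close>

lemma shifted_dom:
  assumes one: "L (mat 1) = mat 1" and k: "eigval (L A) k"
  obtains m where "eigval A m" "cmod (k + of_real s) \<le> cmod (m + of_real s)"
proof -
  have "L (A + s *\<^sub>R mat 1) = L A + s *\<^sub>R mat 1"
    by (simp add: linear_add[OF lin] linear_scale[OF lin] one)
  then have "eigval (L (A + s *\<^sub>R mat 1)) (k + of_real s)" using k by (simp add: eigval_shift)
  from dom[OF this] obtain m where m: "eigval (A + s *\<^sub>R mat 1) m" "cmod (k + of_real s) \<le> cmod m" by blast
  have "eigval A (m - of_real s)" using m(1) eigval_shift[of A s "m - of_real s"] by simp
  with m(2) that[of "m - of_real s"] show ?thesis by simp
qed

end

locale unital_spectral_preserver = spectral_preserver L for L :: "real ^ 'n ^ 'n \<Rightarrow> real ^ 'n ^ 'n" +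
  assumes one: "L (mat 1) = mat 1"
begin

text \<open>\<open>adjoint L (mat 1)\<close> represents the functional A -> tr (L A), which vanishes
  on square-zero matrices. It is therefore scalar, and evaluation at the identity makes the scalar
  1.\<close>

lemma adjoint_one: "adjoint L (mat 1) = mat 1"
proof -
  have adj: "trace (L A) = trace (transpose (adjoint L (mat 1)) ** A)" for A
  proof -
    have "mat 1 \<bullet> L A = adjoint L (mat 1) \<bullet> A"
      using adjoint_works[OF lin] inner_commute by metis
    then show ?thesis by (simp add: inner_matrix_trace)
  qed
  obtain c where c: "transpose (adjoint L (mat 1)) = c *\<^sub>R mat 1"
    using scalar_if_trace_square_zero[of "transpose (adjoint L (mat 1))"] trace_square_zero
    by (metis adj)
  have "trace (mat 1 :: real^'n^'n) = c * trace (mat 1 :: real^'n^'n)"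
    using adj[of "mat 1"] by (simp add: one c matrix_mult_bilinear trace_scaleR)
  then have "c = 1" by (simp add: trace_I)
  with c show ?thesis by (metis scaleR_one transpose_mat transpose_transpose)
qed

lemma trace_preserved: "trace (L A) = trace A"
proof -
  have "mat 1 \<bullet> L A = mat 1 \<bullet> A"
    using adjoint_works[OF lin] inner_commute adjoint_one by metis
  then show ?thesis by (simp add: inner_matrix_trace)
qed

text \<open>The image must have an eigenvalue of modulus nearly t; confinement to a disc forces its
  real part close to t, and the preserved trace t + tr A then bounds all other real parts.
  \<open>e\<close> is arbitrary so that a family carrying its third and fourth power sums can be
  supplied.\<close>

lemma dominant_eigenvalue:
  fixes A :: "real ^ 'n ^ 'n" and v f :: "real ^ 'n"
  assumes fv: "f \<bullet> v = 1"
  obtains K T where "T > 0"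
    "\<And>t e. t \<ge> T \<Longrightarrow> (\<And>k. eigval (L (A + t *\<^sub>R outer v f)) k \<longleftrightarrow> k \<in> range e) \<Longrightarrow>
      of_real (trace (L (A + t *\<^sub>R outer v f))) = (\<Sum>i\<in>(UNIV::'n set). e i) \<Longrightarrow>
      \<exists>i0. cmod (e i0) \<le> t + trace (A ** outer v f) + K / t \<and> (\<forall>i. i \<noteq> i0 \<longrightarrow> (cmod (e i))\<^sup>2 \<le> K * t)"
proof -
  define a where "a = trace (A ** outer v f)"
  define N where "N = real CARD('n)"
  have N: "N \<ge> 1" by (simp add: N_def Suc_leI)
  obtain C0 where C0: "C0 \<ge> 1" "\<And>t \<mu>. t > 0 \<Longrightarrow> eigval (A + t *\<^sub>R outer v f) \<mu> \<Longrightarrow> cmod \<mu> \<le> C0 \<or> cmod (\<mu> - of_real (t + a)) \<le> C0 / t"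
    using eigval_rank_one_perturbation[OF fv, of A] unfolding a_def by metis
  define C where "C = C0 + \<bar>a\<bar> + \<bar>trace A\<bar>"
  have C: "C \<ge> 1" "\<bar>a\<bar> \<le> C" "\<bar>trace A\<bar> \<le> C" "C0 \<le> C" using C0(1) by (auto simp: C_def)
  define K where "K = (N + 20) * C"
  have "\<exists>i0. cmod (e i0) \<le> t + a + K / t \<and> (\<forall>i. i \<noteq> i0 \<longrightarrow> (cmod (e i))\<^sup>2 \<le> K * t)"
    if t: "t \<ge> (N + 4) * C" and e: "\<And>k. eigval (L (A + t *\<^sub>R outer v f)) k \<longleftrightarrow> k \<in> range e"
      and tr: "of_real (trace (L (A + t *\<^sub>R outer v f))) = (\<Sum>i\<in>(UNIV::'n set). e i)" for t e
  proof -
    let ?X = "A + t *\<^sub>R outer v f"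
    have "C \<le> N * C" using mult_right_mono[OF N, of C] C(1) by simp
    with t have tC: "t \<ge> 5 * C" "t \<ge> N * C + 4 * C" by (simp_all add: algebra_simps)
    then have t1: "t \<ge> 1" using C(1) by linarith
    have Ct: "C / t \<le> C" "0 \<le> C / t" using t1 C(1) by (auto simp: field_simps)
    have trX: "trace ?X = trace A + t" using fv by (simp add: trace_add trace_scaleR trace_outer)
    have spec: "cmod \<mu> \<le> C \<or> cmod (\<mu> - of_real (t + a)) \<le> C / t" if "eigval ?X \<mu>" for \<mu>
    proof -
      have "C0 / t \<le> C / t" using C(4) t1 by (intro divide_right_mono) auto
      then show ?thesis using C0(2)[OF _ that] t1 C(4) by (smt (verit))
    qed
    have shift: "cmod (\<kappa> + of_real s) \<le> C + \<bar>s\<bar> \<or> cmod (\<kappa> + of_real s) \<le> \<bar>t + a + s\<bar> + C / t" if "\<kappa> \<in> range e" for \<kappa> s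
    proof -
      from that e have "eigval (L ?X) \<kappa>" by simp
      then obtain m where m: "eigval ?X m" "cmod (\<kappa> + of_real s) \<le> cmod (m + of_real s)"
        using shifted_dom[OF one] by metis
      have "cmod (m + of_real s) \<le> cmod m + \<bar>s\<bar>" by (metis norm_of_real norm_triangle_ineq real_norm_def)
      moreover have "cmod (m + of_real s) \<le> cmod (m - of_real (t + a)) + \<bar>t + a + s\<bar>"
      proof -
        have "m + of_real s = (m - of_real (t + a)) + of_real (t + a + s)" by simp
        then show ?thesis by (metis norm_of_real norm_triangle_ineq)
      qed
      ultimately show ?thesis using m(2) spec[OF m(1)] by linarith
    qed
    \<comment> \<open>The shift 0 bounds the modulus, \<open>- t\<close> bounds the real part from below, and \<open>- t / 2\<close> confines the
      spectrum to a disc with diameter roughly \<open>[0, t]\<close>, whence small real part forces modulus \<open>O(sqrt t)\<close>.\<close>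
    have mod: "cmod (e i) \<le> t + a + C / t" for i
      using shift[of "e i" 0, OF rangeI] unfolding of_real_0 add_0_right
      by (elim disjE) (use C(1,2) Ct tC in linarith)+
    have re: "Re (e i) \<ge> - C" for i
    proof -
      have "t - Re (e i) \<le> cmod (e i + of_real (- t))"
        using abs_Re_le_cmod[of "e i + of_real (- t)"] by simp
      also have "\<dots> \<le> C + t" using shift[of "e i" "- t", OF rangeI]
        by (elim disjE) (use C(1,2) Ct tC in linarith)+
      finally show ?thesis by simp
    qed
    have sq: "(cmod (e i))\<^sup>2 \<le> t * Re (e i) + 6 * C * t" for i
    proof -
      have "cmod (e i + of_real (- (t / 2))) \<le> t / 2 + 2 * C"
        using shift[of "e i" "- (t / 2)", OF rangeI]
        by (elim disjE) (use C(1,2) Ct tC in linarith)+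
      then have "(cmod (e i + of_real (- (t / 2))))\<^sup>2 \<le> (t / 2 + 2 * C)\<^sup>2"
        by (intro power_mono) auto
      moreover have "(cmod (e i + of_real (- (t / 2))))\<^sup>2 = (cmod (e i))\<^sup>2 - t * Re (e i) + t\<^sup>2 / 4"
        by (simp only: cmod_power2) (simp add: power2_eq_square algebra_simps)
      moreover have "C * C \<le> C * t" using C(1) tC by (intro mult_left_mono) auto
      ultimately show ?thesis by (simp add: power2_eq_square algebra_simps)
    qed
    \<comment> \<open>\<open>spec\<close> alone would allow all eigenvalues to stay bounded by C.
      The trace t + tr A excludes this, as t >= (n + 4) C.\<close>
    have "\<exists>\<mu>. eigval ?X \<mu> \<and> cmod \<mu> > C"
    proof (rule ccontr)
      assume "\<not> ?thesis"
      then have le: "cmod \<mu> \<le> C" if "eigval ?X \<mu>" for \<mu> using that by (meson not_le)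
      obtain d :: "'n \<Rightarrow> complex" where d: "\<And>k. eigval ?X k \<longleftrightarrow> k \<in> range d"
        "of_real (trace ?X) = (\<Sum>i\<in>UNIV. d i)" using eigval_family[of ?X] by metis
      have "cmod (\<Sum>i\<in>UNIV. d i) \<le> (\<Sum>i\<in>(UNIV::'n set). C)"
        by (rule sum_norm_le) (simp add: le d(1))
      then have "\<bar>trace ?X\<bar> \<le> N * C" by (simp add: d(2)[symmetric] N_def)
      with trX C tC show False by simp
    qed
    then obtain \<mu> where \<mu>: "eigval ?X \<mu>" "cmod \<mu> > C" by blast
    then have "cmod (\<mu> - of_real (t + a)) \<le> C / t" using spec by fastforce
    moreover have "t + a \<le> cmod \<mu> + cmod (\<mu> - of_real (t + a))"
      using norm_triangle_ineq4[of \<mu> "\<mu> - of_real (t + a)"] by (simp del: of_real_add)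
    ultimately have "cmod \<mu> \<ge> t - 2 * C" using C(2) Ct by linarith
    then obtain i0 where i0: "cmod (e i0) \<ge> t - 2 * C"
    proof -
      obtain m where m: "eigval (L ?X) m" "cmod \<mu> \<le> cmod m" using dom'[OF \<mu>(1)] by blast
      with e obtain i where "m = e i" by auto
      with m(2) \<open>t - 2 * C \<le> cmod \<mu>\<close> have "t - 2 * C \<le> cmod (e i)" by simp
      then show ?thesis by (rule that)
    qed
    \<comment> \<open>Together with \<open>sq\<close>, a modulus of at least t - 2 C forces the real
      part up to t - 10 C.\<close>
    have "(t - 2 * C)\<^sup>2 \<le> (cmod (e i0))\<^sup>2" using i0 tC C(1) by (intro power_mono) auto
    moreover have "(t - 2 * C)\<^sup>2 = t * (t - 4 * C) + 4 * C\<^sup>2" by (simp add: power2_eq_square algebra_simps)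
    moreover have "t * (Re (e i0) + 6 * C) = t * Re (e i0) + 6 * C * t" by (simp add: algebra_simps)
    ultimately have "t * (t - 4 * C) \<le> t * (Re (e i0) + 6 * C)" using sq[of i0] zero_le_power2[of C] by linarith
    then have x0: "Re (e i0) \<ge> t - 10 * C" using t1 by simp
    have sum: "(\<Sum>i\<in>UNIV. Re (e i)) = t + trace A"
      using arg_cong[OF tr, of Re] by (simp add: trace_preserved trX)
    have small: "(cmod (e i))\<^sup>2 \<le> K * t" if "i \<noteq> i0" for i
    proof -
      \<comment> \<open>The 11 is 1 from the trace of A plus 10 from \<open>x0\<close>; the n comes
        from the lower bounds -C on the real parts.\<close>
      have "Re (e i) \<le> (N + 11) * C"
        using sum_exceptional_le[where x = "\<lambda>i. Re (e i)", OF re _ that] C sum x0 by (simp add: N_def algebra_simps)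
      then have "t * Re (e i) \<le> t * ((N + 11) * C)" using t1 by (intro mult_left_mono) auto
      moreover have "t * ((N + 11) * C) + 6 * C * t \<le> K * t" using t1 C(1) by (simp add: K_def algebra_simps)
      ultimately show ?thesis using sq[of i] by linarith
    qed
    have "C \<le> K" unfolding K_def using C(1) N mult_right_mono[of 1 "N + 20" C] by simp
    then have "C / t \<le> K / t" using t1 by (intro divide_right_mono) auto
    then have "cmod (e i0) \<le> t + a + K / t" using mod[of i0] by linarith
    with small show ?thesis by blast
  qed
  moreover have "(N + 4) * C > 0" using N C(1) by simp
  ultimately show ?thesis using that[of "(N + 4) * C" K] unfolding a_def by blast
qed

end

section \<open>Rank one idempotents and traces of powers\<close>

lemma matrix_outer: "M ** outer v f = outer (M *v v) f" "outer v f ** M = outer v (f v* M)"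
  by (simp_all add: outer_def vec_eq_iff matrix_matrix_mult_def matrix_vector_mult_def vector_matrix_mult_def
      sum_distrib_left sum_distrib_right mult_ac)

lemma transpose_outer: "transpose (outer v f) = outer f v"
  by (simp add: outer_def transpose_def vec_eq_iff mult.commute)

lemma eigval_idempotent:
  assumes "P ** P = P" "eigval P k"
  shows "k = 0 \<or> k = 1"
proof -
  from assms(2)[unfolded mat_eigenvalue_def] obtain w where w: "w \<noteq> 0" "cmat P *v w = k *s w" by blast
  have "cmat P ** cmat P = cmat P" using assms(1) by (simp add: cmat_mult[symmetric])
  then have "cmat P *v (cmat P *v w) = cmat P *v w" by (simp add: matrix_vector_mul_assoc)
  then have "(k * k) *s w = k *s w" by (simp add: w(2) vec.scale)
  then have "(k * k - k) *s w = 0" by (simp add: vec_eq_iff algebra_simps)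
  with w(1) have "k * (k - 1) = 0" by (simp add: algebra_simps)
  then show ?thesis by simp
qed

text \<open>The eigenvalues of an idempotent are 0 and 1, so its trace counts the ones, while a
  nonzero vector of the range would be an eigenvector for 1.\<close>

lemma idempotent_trace_zero:
  fixes Q :: "real ^ 'n ^ 'n"
  assumes idem: "Q ** Q = Q" and tr: "trace Q = 0"
  shows "Q = 0"
proof (rule ccontr)
  assume "Q \<noteq> 0"
  then obtain u where u: "Q *v u \<noteq> 0" by (metis matrix_eq matrix_vector_mult_0)
  define w where "w = (\<chi> i. complex_of_real ((Q *v u) $ i))"
  have "Q *v (Q *v u) = Q *v u" by (simp add: matrix_vector_mul_assoc idem)
  then have "cmat Q *v w = w"
    by (simp add: w_def vec_eq_iff matrix_vector_mult_def flip: of_real_mult of_real_sum)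
  moreover have "w \<noteq> 0" using u by (auto simp: w_def vec_eq_iff)
  ultimately have one: "eigval Q 1" unfolding mat_eigenvalue_def by (intro exI[of _ w]) simp
  obtain e :: "'n \<Rightarrow> complex" where e: "\<And>k. eigval Q k \<longleftrightarrow> k \<in> range e"
    "of_real (trace Q) = (\<Sum>i\<in>UNIV. e i)" using eigval_family[of Q] by metis
  have e01: "e i = 0 \<or> e i = 1" for i using eigval_idempotent[OF idem] e(1) by blast
  have nn: "Re (e i) \<ge> 0" for i using e01[of i] by auto
  have "(\<Sum>i\<in>UNIV. Re (e i)) = 0" using arg_cong[OF e(2), of Re] tr by simp
  then have "Re (e i) = 0" for i using nn by (simp add: sum_nonneg_eq_0_iff)
  moreover obtain i where "e i = 1" using one e(1) by auto
  ultimately show False by (metis one_complex.sel(1) zero_neq_one)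
qed

text \<open>Take v in the range of P, and f as v^T P rescaled to f v = 1. Then P v = v and f P = f,
  so P minus the outer product is again idempotent, has trace 0, and vanishes.\<close>

lemma idempotent_trace_one:
  fixes P :: "real ^ 'n ^ 'n"
  assumes idem: "P ** P = P" and tr: "trace P = 1"
  obtains v f where "f \<bullet> v = 1" "P = outer v f"
proof -
  have "P \<noteq> 0" using tr by (auto simp: trace_def)
  then obtain u where u: "P *v u \<noteq> 0" by (metis matrix_eq matrix_vector_mult_0)
  define v where "v = P *v u"
  define f where "f = (1 / (v \<bullet> v)) *\<^sub>R (v v* P)"
  have Pv: "P *v v = v" by (simp add: v_def matrix_vector_mul_assoc idem)
  have fP: "f v* P = f"
    using idem by (simp add: f_def scaleR_vector_matrix_assoc vector_matrix_mul_assoc)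
  have "(v v* P) \<bullet> v = v \<bullet> v" by (simp add: dot_lmul_matrix Pv)
  then have fv: "f \<bullet> v = 1" using u by (simp add: f_def v_def)
  define Q where "Q = P - outer v f"
  have "Q ** Q = Q"
  proof -
    have "P ** outer v f = outer v f" by (simp add: matrix_outer(1) Pv)
    moreover have "outer v f ** P = outer v f" by (simp add: matrix_outer(2) fP)
    moreover have "outer v f ** outer v f = outer v f" by (simp add: outer_mult fv)
    ultimately show ?thesis by (simp add: Q_def matrix_mult_bilinear idem)
  qed
  moreover have "trace Q = 0" by (simp add: Q_def trace_sub tr trace_outer fv)
  ultimately have "Q = 0" by (rule idempotent_trace_zero)
  then show ?thesis using that[OF fv] by (simp add: Q_def)
qed

lemma trace_matrix_eqI:
  fixes M N :: "real ^ 'n ^ 'n"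
  assumes "\<And>B. trace (B ** M) = trace (B ** N)"
  shows "M = N"
proof -
  have "M $ i $ j = N $ i $ j" for i j
    using assms[of "munit j i"] by (simp add: trace_mul_sym[of "munit j i"] trace_munit)
  then show ?thesis by (simp add: vec_eq_iff)
qed

lemma trace_cube_expand:
  fixes P R :: "real ^ 'n ^ 'n"
  shows "trace ((P + t *\<^sub>R R) ** (P + t *\<^sub>R R) ** (P + t *\<^sub>R R)) =
    t ^ 3 * trace (R ** R ** R) + 3 * t\<^sup>2 * trace (P ** R ** R) + t * (3 * trace (P ** P ** R)) + trace (P ** P ** P)"
proof -
  have c: "trace (R ** P ** R) = trace (P ** R ** R)" "trace (R ** R ** P) = trace (P ** R ** R)"
    "trace (P ** R ** P) = trace (P ** P ** R)" "trace (R ** P ** P) = trace (P ** P ** R)"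
    by (metis matrix_mul_assoc trace_mul_sym)+
  show ?thesis
    by (simp add: matrix_mult_bilinear trace_add trace_scaleR c power2_eq_square power3_eq_cube algebra_simps)
qed

text \<open>Cyclicity identifies the four words with a single P, which yields the coefficient of
  t^3. The lower coefficients stay unspecified because they disappear in the limit.\<close>

lemma trace_fourth_expand:
  fixes P R :: "real ^ 'n ^ 'n"
  obtains c2 c1 c0 where "\<And>t. trace ((P + t *\<^sub>R R) ** (P + t *\<^sub>R R) ** (P + t *\<^sub>R R) ** (P + t *\<^sub>R R)) =
    t ^ 4 * trace (R ** R ** R ** R) + 4 * t ^ 3 * trace (P ** R ** R ** R) + t\<^sup>2 * c2 + t * c1 + c0"
proof -
  let ?tr = "\<lambda>A B C D. trace (A ** B ** C ** (D :: real ^ 'n ^ 'n))"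
  have c: "?tr R P R R = ?tr P R R R" "?tr R R P R = ?tr P R R R" "?tr R R R P = ?tr P R R R"
    by (metis matrix_mul_assoc trace_mul_sym)+
  have "?tr (P + t *\<^sub>R R) (P + t *\<^sub>R R) (P + t *\<^sub>R R) (P + t *\<^sub>R R) =
    t ^ 4 * ?tr R R R R + 4 * t ^ 3 * ?tr P R R R +
    t\<^sup>2 * (?tr P P R R + ?tr P R P R + ?tr P R R P + ?tr R P P R + ?tr R P R P + ?tr R R P P) +
    t * (?tr P P P R + ?tr P P R P + ?tr P R P P + ?tr R P P P) + ?tr P P P P" for t
    by (simp add: matrix_mult_bilinear trace_add trace_scaleR c power2_eq_square power3_eq_cube power4_eq_xxxx algebra_simps)
  with that show ?thesis by blast
qed

section \<open>Images of rank one idempotents\<close>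

lemma sum_power_exceptional_le:
  fixes e :: "'n::finite \<Rightarrow> complex"
  assumes i0: "cmod (e i0) \<le> x" and small: "\<And>i. i \<noteq> i0 \<Longrightarrow> (cmod (e i))\<^sup>2 \<le> y" and y: "y \<ge> 0"
  shows "cmod (\<Sum>i\<in>UNIV. e i ^ k) \<le> x ^ k + real CARD('n) * sqrt y ^ k"
proof -
  have le: "cmod (e i) \<le> sqrt y" if "i \<noteq> i0" for i using small[OF that] by (rule real_le_rsqrt)
  have "cmod (\<Sum>i\<in>UNIV. e i ^ k) \<le> (\<Sum>i\<in>UNIV. cmod (e i) ^ k)"
    using norm_sum[of "\<lambda>i. e i ^ k" UNIV] by (simp add: norm_power)
  also have "\<dots> = cmod (e i0) ^ k + (\<Sum>i\<in>UNIV - {i0}. cmod (e i) ^ k)"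
    by (simp add: sum.remove[of UNIV i0])
  also have "\<dots> \<le> x ^ k + (\<Sum>i\<in>UNIV - {i0}. sqrt y ^ k)"
    using i0 le by (intro add_mono sum_mono power_mono) auto
  also have "(\<Sum>i\<in>UNIV - {i0}. sqrt y ^ k) \<le> (\<Sum>i\<in>(UNIV :: 'n set). sqrt y ^ k)"
    using y by (intro sum_mono2) auto
  finally show ?thesis by simp
qed

context unital_spectral_preserver
begin

text \<open>The shift by -1/2 puts the spectrum of the image into the disc with diameter [0, 1],
  where |z|^2 <= Re z. The real parts are thus nonnegative with sum 1, and some eigenvalue has
  modulus at least 1: it equals 1 and leaves only zeros.\<close>

lemma spectrum_image_rank_one_idempotent:
  assumes fv: "f \<bullet> v = 1" and e: "\<And>k. eigval (L (outer v f)) k \<longleftrightarrow> k \<in> range e"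
    and tr: "of_real (trace (L (outer v f))) = (\<Sum>i\<in>(UNIV::'n set). e i)" and k: "k > 0"
  shows "(\<Sum>i\<in>UNIV. e i ^ k) = 1"
proof -
  have idem: "outer v f ** outer v f = outer v f" by (simp add: outer_mult fv)
  have disc: "(cmod (e i))\<^sup>2 \<le> Re (e i)" for i
  proof -
    have "eigval (L (outer v f)) (e i)" by (simp add: e)
    from shifted_dom[OF one this, of "- 1 / 2"] obtain m
      where m: "eigval (outer v f) m" "cmod (e i + of_real (- 1 / 2)) \<le> cmod (m + of_real (- 1 / 2))" by blast
    have "cmod (m + of_real (- 1 / 2)) = 1 / 2" using eigval_idempotent[OF idem m(1)] by (auto simp: cmod_def)
    with m(2) have "(cmod (e i + of_real (- 1 / 2)))\<^sup>2 \<le> (1 / 2)\<^sup>2" by (intro power_mono) auto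
    moreover have "(cmod (e i + of_real (- 1 / 2)))\<^sup>2 = (cmod (e i))\<^sup>2 - Re (e i) + 1 / 4"
      by (simp only: cmod_power2) (simp add: power2_eq_square algebra_simps)
    ultimately show ?thesis by (simp add: power2_eq_square)
  qed
  have nn: "Re (e i) \<ge> 0" for i using disc[of i] zero_le_power2[of "cmod (e i)"] by linarith
  have sum: "(\<Sum>i\<in>UNIV. Re (e i)) = 1"
    using arg_cong[OF tr, of Re] by (simp add: trace_preserved trace_outer fv)
  obtain m where "eigval (outer v f) m" "m \<noteq> 0"
  proof -
    obtain d :: "'n \<Rightarrow> complex" where d: "\<And>k. eigval (outer v f) k \<longleftrightarrow> k \<in> range d"
      "of_real (trace (outer v f)) = (\<Sum>i\<in>UNIV. d i)" using eigval_family[of "outer v f"] by metis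
    have "\<exists>i. d i \<noteq> 0"
    proof (rule ccontr)
      assume "\<not> ?thesis"
      then have "(\<Sum>i\<in>UNIV. d i) = 0" by simp
      with d(2) show False by (simp add: trace_outer fv)
    qed
    with d(1) that show ?thesis by auto
  qed
  then have "eigval (outer v f) 1" using eigval_idempotent[OF idem] by auto
  then obtain k0 where "eigval (L (outer v f)) k0" "1 \<le> cmod k0" using dom' by fastforce
  then obtain i0 where i0: "1 \<le> cmod (e i0)" using e by auto
  have "Re (e i0) \<le> 1" using sum member_le_sum[of i0 UNIV "\<lambda>i. Re (e i)"] nn by simp
  moreover have "1 \<le> (cmod (e i0))\<^sup>2" using i0 by (simp add: one_le_power)
  ultimately have re1: "Re (e i0) = 1" and sq1: "(cmod (e i0))\<^sup>2 = 1" using disc[of i0] by linarith+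
  have e1: "e i0 = 1" using re1 sq1 by (simp add: complex_eq_iff cmod_power2)
  have "(\<Sum>i\<in>UNIV - {i0}. Re (e i)) = 0" using sum re1 by (simp add: sum.remove[of UNIV i0])
  then have "\<forall>i\<in>UNIV - {i0}. Re (e i) = 0" using nn by (subst (asm) sum_nonneg_eq_0_iff) auto
  then have e0: "e i = 0" if "i \<noteq> i0" for i using disc[of i] that by auto
  have "(\<Sum>i\<in>UNIV. e i ^ k) = e i0 ^ k + (\<Sum>i\<in>UNIV - {i0}. e i ^ k)" by (simp add: sum.remove[of UNIV i0])
  also have "(\<Sum>i\<in>UNIV - {i0}. e i ^ k) = 0" using e0 k by (intro sum.neutral) auto
  finally show ?thesis by (simp add: e1)
qed

lemma trace_powers_image:
  assumes fv: "f \<bullet> v = 1"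
  defines "R \<equiv> L (outer v f)"
  shows "trace (R ** R) = 1" "trace (R ** R ** R) = 1" "trace (R ** R ** R ** R) = 1"
proof -
  obtain e :: "'n \<Rightarrow> complex" where e: "\<And>k. eigval R k \<longleftrightarrow> k \<in> range e"
    "of_real (trace R) = (\<Sum>i\<in>UNIV. e i)" "of_real (trace (R ** R)) = (\<Sum>i\<in>UNIV. e i ^ 2)"
    "of_real (trace (R ** R ** R)) = (\<Sum>i\<in>UNIV. e i ^ 3)"
    "of_real (trace (R ** R ** R ** R)) = (\<Sum>i\<in>UNIV. e i ^ 4)" using eigval_family[of R] by metis
  note s = spectrum_image_rank_one_idempotent[OF fv e(1,2)[unfolded R_def]]
  show "trace (R ** R) = 1" "trace (R ** R ** R) = 1" "trace (R ** R ** R ** R) = 1"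
    using s[of 2] s[of 3] s[of 4] e(3-5) by simp_all
qed

text \<open>Traces of powers of L A + t R are bounded through the eigenvalues and also expanded in
  t. As R^3 and R^4 have trace 1, the leading terms cancel, and letting t grow compares the next
  coefficients.\<close>

lemma trace_power_image_le:
  assumes fv: "f \<bullet> v = 1"
  defines "R \<equiv> L (outer v f)"
  shows "trace (L A ** R ** R) \<le> trace (A ** outer v f)"
    and "trace (L A ** R ** R ** R) \<le> trace (A ** outer v f)"
proof -
  define a where "a = trace (A ** outer v f)"
  define X where "X = (\<lambda>t. L A + t *\<^sub>R R)"
  have LX: "L (A + t *\<^sub>R outer v f) = X t" for t
    by (simp add: linear_add[OF lin] linear_scale[OF lin] X_def R_def)
  obtain K T where T: "T > 0" and K: "\<And>t e. t \<ge> T \<Longrightarrow> (\<And>k. eigval (X t) k \<longleftrightarrow> k \<in> range e) \<Longrightarrow>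
      of_real (trace (X t)) = (\<Sum>i\<in>(UNIV::'n set). e i) \<Longrightarrow>
      \<exists>i0. cmod (e i0) \<le> t + a + K / t \<and> (\<forall>i. i \<noteq> i0 \<longrightarrow> (cmod (e i))\<^sup>2 \<le> K * t)"
    using dominant_eigenvalue[OF fv, of A] unfolding LX a_def by metis
  \<comment> \<open>Enlarging K keeps both bounds, and nonnegativity of \<open>K' * t\<close> is
    what the square roots below need.\<close>
  define K' where "K' = \<bar>K\<bar>"
  define N where "N = real CARD('n)"
  have pow: "\<bar>trace (X t ** X t ** X t)\<bar> \<le> (t + a + K' / t) ^ 3 + N * sqrt (K' * t) ^ 3"
    "\<bar>trace (X t ** X t ** X t ** X t)\<bar> \<le> (t + a + K' / t) ^ 4 + N * sqrt (K' * t) ^ 4" if t: "t \<ge> T" for t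
  proof -
    obtain e :: "'n \<Rightarrow> complex" where e: "\<And>k. eigval (X t) k \<longleftrightarrow> k \<in> range e"
      "of_real (trace (X t)) = (\<Sum>i\<in>UNIV. e i)" 
      "of_real (trace (X t ** X t ** X t)) = (\<Sum>i\<in>UNIV. e i ^ 3)"
      "of_real (trace (X t ** X t ** X t ** X t)) = (\<Sum>i\<in>UNIV. e i ^ 4)" using eigval_family[of "X t"] by metis
    from K[OF t e(1,2)] obtain i0 where i0: "cmod (e i0) \<le> t + a + K / t" "\<And>i. i \<noteq> i0 \<Longrightarrow> (cmod (e i))\<^sup>2 \<le> K * t"
      by blast
    have t0: "t > 0" using t T by linarith
    have "K / t \<le> K' / t" "K * t \<le> K' * t" "0 \<le> K' * t"
      using t0 by (auto simp: K'_def intro!: divide_right_mono mult_right_mono)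
    then have b: "cmod (e i0) \<le> t + a + K' / t" "\<And>i. i \<noteq> i0 \<Longrightarrow> (cmod (e i))\<^sup>2 \<le> K' * t" "0 \<le> K' * t"
      using i0 by (force intro: order_trans)+
    have p: "cmod (\<Sum>i\<in>UNIV. e i ^ k) \<le> (t + a + K' / t) ^ k + N * sqrt (K' * t) ^ k" for k
      unfolding N_def using b by (rule sum_power_exceptional_le)
    show "\<bar>trace (X t ** X t ** X t)\<bar> \<le> (t + a + K' / t) ^ 3 + N * sqrt (K' * t) ^ 3"
      using p[of 3] by (simp only: e(3)[symmetric] norm_of_real)
    show "\<bar>trace (X t ** X t ** X t ** X t)\<bar> \<le> (t + a + K' / t) ^ 4 + N * sqrt (K' * t) ^ 4"
      using p[of 4] by (simp only: e(4)[symmetric] norm_of_real)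
  qed
  note tp = trace_powers_image[OF fv, folded R_def]
  show "trace (L A ** R ** R) \<le> trace (A ** outer v f)"
  proof -
    define b where "b = trace (L A ** R ** R)"
    define c1 where "c1 = 3 * trace (L A ** L A ** R)"
    define c0 where "c0 = trace (L A ** L A ** L A)"
    have "0 \<le> 3 * (a - b)"
    proof (rule tendsto_lowerbound[OF tendsto_cube_gap[of a K' "N * sqrt K' ^ 3" b c1 c0]])
      have "0 \<le> ((t + a + K' / t) ^ 3 + N * sqrt K' ^ 3 * t powr (3 / 2) - (t ^ 3 + 3 * t\<^sup>2 * b + t * c1 + c0)) / t\<^sup>2"
        if t: "t \<ge> T" for t
      proof -
        have t0: "t > 0" using t T by linarith
        have "sqrt t ^ 3 = t powr (3 / 2)"
          using t0 by (simp add: powr_half_sqrt[symmetric] powr_powr flip: powr_realpow)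
        then have "N * sqrt (K' * t) ^ 3 = N * sqrt K' ^ 3 * t powr (3 / 2)"
          by (simp add: real_sqrt_mult power_mult_distrib)
        moreover have "trace (X t ** X t ** X t) = t ^ 3 + 3 * t\<^sup>2 * b + t * c1 + c0"
          by (simp add: X_def trace_cube_expand tp b_def c1_def c0_def)
        ultimately show ?thesis using pow(1)[OF t] by (intro divide_nonneg_nonneg) auto
      qed
      then show "\<forall>\<^sub>F t in at_top. 0 \<le> ((t + a + K' / t) ^ 3 + N * sqrt K' ^ 3 * t powr (3 / 2) - (t ^ 3 + 3 * t\<^sup>2 * b + t * c1 + c0)) / t\<^sup>2"
        unfolding eventually_at_top_linorder by blast
    qed simp
    then show ?thesis by (simp add: a_def b_def)
  qed
  show "trace (L A ** R ** R ** R) \<le> trace (A ** outer v f)"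
  proof -
    define b where "b = trace (L A ** R ** R ** R)"
    obtain c2 c1 c0 where exp: "\<And>t. trace (X t ** X t ** X t ** X t) =
        t ^ 4 * trace (R ** R ** R ** R) + 4 * t ^ 3 * b + t\<^sup>2 * c2 + t * c1 + c0"
      using trace_fourth_expand[of "L A" R] unfolding X_def b_def by metis
    have "0 \<le> 4 * (a - b)"
    proof (rule tendsto_lowerbound[OF tendsto_fourth_gap[of a K' "N * sqrt K' ^ 4" b c2 c1 c0]])
      have "0 \<le> ((t + a + K' / t) ^ 4 + N * sqrt K' ^ 4 * t\<^sup>2 - (t ^ 4 + 4 * t ^ 3 * b + t\<^sup>2 * c2 + t * c1 + c0)) / t ^ 3"
        if t: "t \<ge> T" for t
      proof -
        have t0: "t > 0" using t T by linarith
        have "sqrt t ^ 4 = (sqrt t)\<^sup>2 * (sqrt t)\<^sup>2" by (simp only: power2_eq_square power4_eq_xxxx mult.assoc)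
        also have "\<dots> = t\<^sup>2"
          by (simp only: real_sqrt_pow2[OF less_imp_le[OF t0]] power2_eq_square[of t])
        finally have "N * sqrt (K' * t) ^ 4 = N * sqrt K' ^ 4 * t\<^sup>2"
          by (simp add: real_sqrt_mult power_mult_distrib)
        then show ?thesis using pow(2)[OF t] t0 unfolding exp tp by (intro divide_nonneg_nonneg) auto
      qed
      then show "\<forall>\<^sub>F t in at_top. 0 \<le> ((t + a + K' / t) ^ 4 + N * sqrt K' ^ 4 * t\<^sup>2 - (t ^ 4 + 4 * t ^ 3 * b + t\<^sup>2 * c2 + t * c1 + c0)) / t ^ 3"
        unfolding eventually_at_top_linorder by blast
    qed simp
    then show ?thesis by (simp add: a_def b_def)
  qed
qed

text \<open>With R the image of the idempotent, R^2 and R^3 represent the same functional on the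
  range of L, which is everything. Hence R^2 = R^3 = R^4, and R^2 is an idempotent of trace
  1.\<close>

lemma image_rank_one_idempotent:
  assumes fv: "f \<bullet> v = 1"
  obtains w g where "g \<bullet> w = 1" "\<And>A. trace (L A ** outer w g) = trace (A ** outer v f)"
proof -
  define R where "R = L (outer v f)"
  have neg: "trace (- M ** N) = - trace (M ** N)" for M N :: "real ^ 'n ^ 'n"
    using matrix_mult_bilinear(3)[of "- 1" M N] trace_scaleR[of "- 1" "M ** N"] by simp
  \<comment> \<open>The bounds are linear in \<open>A\<close>, so applying them to \<open>- A\<close> turns them into equalities.\<close>
  have two: "trace (L A ** (R ** R)) = trace (A ** outer v f)" for A
    using trace_power_image_le(1)[OF fv, of A] trace_power_image_le(1)[OF fv, of "- A"]
    by (simp add: linear_neg[OF lin] neg R_def flip: matrix_mul_assoc)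
  have three: "trace (L A ** (R ** R ** R)) = trace (A ** outer v f)" for A
    using trace_power_image_le(2)[OF fv, of A] trace_power_image_le(2)[OF fv, of "- A"]
    by (simp add: linear_neg[OF lin] neg R_def flip: matrix_mul_assoc)
  have eq: "R ** R = R ** R ** R"
  proof (rule trace_matrix_eqI)
    fix B
    obtain A where "B = L A" using surjD[OF onto] by blast
    then show "trace (B ** (R ** R)) = trace (B ** (R ** R ** R))" by (simp only: two three)
  qed
  then have "(R ** R) ** (R ** R) = R ** R" by (metis matrix_mul_assoc)
  moreover have "trace (R ** R) = 1" using trace_powers_image(1)[OF fv] by (simp add: R_def)
  ultimately obtain w g where "g \<bullet> w = 1" "R ** R = outer w g" using idempotent_trace_one by blast
  with two that show ?thesis by metis
qed

end

section \<open>Linear maps preserving rank one idempotents\<close>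

lemma outer_minor: "outer w g $ p $ q * outer w g $ r $ s = outer w g $ p $ s * outer w g $ r $ q"
  by (simp add: outer_def)

lemma munit_outer: "munit i j = outer (axis i 1) (axis j 1)"
  by (simp add: vec_eq_iff munit_nth outer_def axis_def)

text \<open>The 2 by 2 minor through the entry (i, i) has linear part s M_pq and otherwise only
  terms in s^2, so s = 1 and s = -1 together give M_pq = 0. The constant trace then removes
  M_ii.\<close>

lemma rank_one_idempotent_direction:
  fixes M :: "real ^ 'n ^ 'n"
  assumes "\<And>s. \<exists>w g. g \<bullet> w = 1 \<and> munit i i + s *\<^sub>R M = outer w g"
  shows "p \<noteq> i \<Longrightarrow> q \<noteq> i \<Longrightarrow> M $ p $ q = 0" "M $ i $ i = 0"
proof -
  have minor: "(1 + s * M $ i $ i) * (s * M $ p $ q) = (s * M $ i $ q) * (s * M $ p $ i)"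
    if "p \<noteq> i" "q \<noteq> i" for p q s
  proof -
    obtain w g where wg: "munit i i + s *\<^sub>R M = outer w g" using assms[of s] by blast
    show ?thesis using outer_minor[of w g i i p q] that unfolding wg[symmetric] by (simp add: munit_nth)
  qed
  have *: "M $ p $ q = 0" if "p \<noteq> i" "q \<noteq> i" for p q
    using minor[OF that, of 1] minor[OF that, of "- 1"] by (simp add: algebra_simps)
  then show "p \<noteq> i \<Longrightarrow> q \<noteq> i \<Longrightarrow> M $ p $ q = 0" .
  obtain w g where wg: "g \<bullet> w = 1" "munit i i + 1 *\<^sub>R M = outer w g" using assms[of 1] by blast
  have "trace (munit i i + M) = 1" using wg by (simp add: trace_outer)
  moreover have "trace (munit i i :: real ^ 'n ^ 'n) = 1" by (simp add: munit_outer trace_outer inner_axis_axis)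
  moreover have "trace M = (\<Sum>p\<in>UNIV. if p = i then M $ i $ i else 0)"
    unfolding trace_def using * by (intro sum.cong) auto
  ultimately show "M $ i $ i = 0" by (simp add: trace_add)
qed

definition dg :: "('n \<Rightarrow> real) \<Rightarrow> real ^ 'n ^ 'n" where
  "dg d = (\<chi> i j. if i = j then d i else 0)"

lemma dg_mult: "(dg d ** A ** dg e) $ p $ q = d p * A $ p $ q * e q"
proof -
  have "(dg d ** A) $ p $ j = d p * A $ p $ j" for j
    by (simp add: dg_def matrix_matrix_mult_def if_distrib[of "\<lambda>x. x * _"] cong: if_cong)
  then have "(dg d ** A ** dg e) $ p $ q = (\<Sum>j\<in>UNIV. if j = q then d p * A $ p $ j * e j else 0)"
    unfolding matrix_matrix_mult_def[of "dg d ** A"] vec_lambda_beta by (intro sum.cong) (auto simp: dg_def)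
  then show ?thesis by simp
qed

lemma dg_inverse:
  fixes d e :: "'n::finite \<Rightarrow> real"
  assumes "\<And>i. d i * e i = 1"
  shows "dg d ** dg e = mat 1"
proof -
  have "(dg d ** mat 1 ** dg e) $ p $ q = (mat 1 :: real ^ 'n ^ 'n) $ p $ q" for p q
    unfolding dg_mult using assms by (simp add: mat_def)
  then show ?thesis by (simp add: vec_eq_iff)
qed

text \<open>K sends E_ij into the span of E_ij and E_ji, with coefficients \<open>a\<close> and
  \<open>b\<close>. Vanishing minors make one of the two families disappear off the diagonal and the
  other multiplicative, and a multiplicative family is a conjugation by a diagonal matrix.\<close>

lemma fixes_diagonal_structure:
  fixes K :: "real ^ 'n ^ 'n \<Rightarrow> real ^ 'n ^ 'n"
  assumes lin: "linear K" and diag: "\<And>i. K (munit i i) = munit i i"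
    and rk: "\<And>v f. f \<bullet> v = 1 \<Longrightarrow> \<exists>w g. g \<bullet> w = 1 \<and> K (outer v f) = outer w g"
  obtains T S where "T ** S = mat 1" "(\<forall>A. K A = T ** A ** S) \<or> (\<forall>A. K A = T ** transpose A ** S)"
proof -
  define a where "a i j = K (munit i j) $ i $ j" for i j
  \<comment> \<open>For i = j the two matrix units coincide; the zero prevents counting the diagonal
    twice.\<close>
  define b where "b i j = (if i = j then 0 else K (munit i j) $ j $ i)" for i j
  have a1: "a i i = 1" and b0: "b i i = 0" for i by (simp_all add: a_def b_def diag munit_nth)
  have Kunit: "K (munit i j) $ p $ q = a i j * munit i j $ p $ q + b i j * munit j i $ p $ q" for i j p q
  proof (cases "i = j")
    case True
    then show ?thesis by (simp add: diag a1 b0)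
  next
    case False
    \<comment> \<open>E_ii + s E_ij and, below, E_jj + s E_ij are rank one idempotents for all s.
      Used at both i and j, the direction lemma leaves only the entries (i, j) and (j, i).\<close>
    have "\<exists>w g. g \<bullet> w = 1 \<and> munit i i + s *\<^sub>R K (munit i j) = outer w g" for s
    proof -
      have "munit i i + s *\<^sub>R munit i j = outer (axis i 1) (axis i 1 + s *\<^sub>R axis j 1)"
        by (simp add: vec_eq_iff munit_nth outer_def axis_def)
      moreover have "(axis i 1 + s *\<^sub>R axis j 1) \<bullet> (axis i 1 :: real ^ 'n) = 1"
        using False by (simp add: inner_add_left inner_axis_axis)
      ultimately show ?thesis using rk
        by (metis diag linear_add[OF lin] linear_scale[OF lin])
    qed
    note di = rank_one_idempotent_direction[OF this]
    have "\<exists>w g. g \<bullet> w = 1 \<and> munit j j + s *\<^sub>R K (munit i j) = outer w g" for s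
    proof -
      have "munit j j + s *\<^sub>R munit i j = outer (axis j 1 + s *\<^sub>R axis i 1) (axis j 1)"
        by (simp add: vec_eq_iff munit_nth outer_def axis_def)
      moreover have "axis j 1 \<bullet> (axis j 1 + s *\<^sub>R axis i 1 :: real ^ 'n) = 1"
        using False by (simp add: inner_add_right inner_axis_axis)
      ultimately show ?thesis using rk
        by (metis diag linear_add[OF lin] linear_scale[OF lin])
    qed
    note dj = rank_one_idempotent_direction[OF this]
    have "K (munit i j) $ p $ q = 0" if "\<not> (p = i \<and> q = j)" "\<not> (p = j \<and> q = i)"
      using that False di dj by metis
    with False show ?thesis by (auto simp: a_def b_def munit_nth)
  qed
  have K: "K A $ p $ q = a p q * A $ p $ q + b q p * A $ q $ p" for A p q
  proof -
    have "K A = (\<Sum>i\<in>UNIV. \<Sum>j\<in>UNIV. A $ i $ j *\<^sub>R K (munit i j))"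
      by (subst matrix_sum_munit) (simp add: linear_sum[OF lin] linear_scale[OF lin])
    then have "K A $ p $ q = (\<Sum>i\<in>UNIV. \<Sum>j\<in>UNIV. A $ i $ j * a i j * munit i j $ p $ q) +
      (\<Sum>i\<in>UNIV. \<Sum>j\<in>UNIV. A $ i $ j * b i j * munit j i $ p $ q)"
      by (simp add: Kunit sum.distrib distrib_left mult_ac)
    also have "(\<Sum>i\<in>UNIV. \<Sum>j\<in>UNIV. A $ i $ j * a i j * munit i j $ p $ q) =
      (\<Sum>i\<in>UNIV. \<Sum>j\<in>UNIV. if j = q then (if i = p then A $ i $ j * a i j else 0) else 0)"
      by (intro sum.cong refl) (auto simp: munit_nth)
    also have "(\<Sum>i\<in>UNIV. \<Sum>j\<in>UNIV. A $ i $ j * b i j * munit j i $ p $ q) =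
      (\<Sum>i\<in>UNIV. \<Sum>j\<in>UNIV. if j = p then (if i = q then A $ i $ j * b i j else 0) else 0)"
      by (intro sum.cong refl) (auto simp: munit_nth)
    finally show ?thesis by (simp add: mult_ac)
  qed
  have scaled: "(a p q / t + b q p * t) * (a q r * t + b r q / t) = a p r + b r p"
    if "p \<noteq> q" "r \<noteq> q" "t \<noteq> 0" for p q r t
  proof -
    \<comment> \<open>The rank one idempotent with entries \<open>x p / (n * x q)\<close> has no vanishing entry, and \<open>t\<close> separates
      the contributions of \<open>a\<close> and \<open>b\<close> to its image.\<close>
    define x where "x = (\<chi> k. if k = q then t else (1 :: real))"
    define y where "y = (\<chi> k. 1 / (real CARD('n) * x $ k))"
    have x0: "x $ k \<noteq> 0" for k using that(3) by (simp add: x_def)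
    have "y \<bullet> x = 1" using x0 by (simp add: y_def inner_vec_def)
    then obtain w g where wg: "K (outer x y) = outer w g" using rk by blast
    have Kxy: "outer w g $ k $ l = (a k l * x $ k / x $ l + b l k * x $ l / x $ k) / real CARD('n)" for k l
      by (simp add: wg[symmetric] K) (simp add: outer_def y_def add_divide_distrib mult.commute[of "real CARD('n)"])
    have "(a p q * x $ p / x $ q + b q p * x $ q / x $ p) * (a q r * x $ q / x $ r + b r q * x $ r / x $ q) =
      (a p r * x $ p / x $ r + b r p * x $ r / x $ p) * (a q q * x $ q / x $ q + b q q * x $ q / x $ q)"
      using outer_minor[of w g p q q r] by (simp add: Kxy)
    then show ?thesis using that x0 by (simp add: x_def a1 b0)
  qed
  have rel: "b q p * a q r = 0" "a p q * b r q = 0" "a p q * a q r + b q p * b r q = a p r + b r p"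
    if "p \<noteq> q" "r \<noteq> q" for p q r
  proof -
    define u where "u = a p q * a q r + b q p * b r q - (a p r + b r p)"
    define X where "X = b q p * a q r"
    define Y where "Y = a p q * b r q"
    have e: "X * t\<^sup>2 + Y / t\<^sup>2 + u = 0" if "t \<noteq> 0" for t
      using scaled[OF \<open>p \<noteq> q\<close> \<open>r \<noteq> q\<close> that] that
      by (simp add: u_def X_def Y_def field_simps power2_eq_square)
    \<comment> \<open>Three values of t suffice to separate the coefficients of t^2, 1/t^2 and
      1.\<close>
    have "X + Y + u = 0" "4 * X + Y / 4 + u = 0" "9 * X + Y / 9 + u = 0"
      using e[of 1] e[of 2] e[of 3] by simp_all
    then have "X = 0 \<and> Y = 0 \<and> u = 0" by linarith
    then show "b q p * a q r = 0" "a p q * b r q = 0" "a p q * a q r + b q p * b r q = a p r + b r p"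
      by (simp_all add: u_def X_def Y_def del: mult_eq_0_iff)
  qed
  have pair: "a p q * a q p + b q p * b p q = 1" if "p \<noteq> q" for p q
    using rel(3)[OF that that] by (simp add: a1 b0)
  \<comment> \<open>An arbitrary base index, through which every coefficient will be
    factored.\<close>
  define o' where "o' = (undefined :: 'n)"
  show ?thesis
  proof (cases "\<exists>p q. p \<noteq> q \<and> a p q \<noteq> 0")
    case True
    then obtain p q where pq: "p \<noteq> q" "a p q \<noteq> 0" by blast
    \<comment> \<open>One nonzero off-diagonal \<open>a p q\<close> clears column q of
      \<open>b\<close>; by \<open>pair\<close> the entries \<open>a r q\<close> are then nonzero,
      and they clear the remaining rows of \<open>b\<close>.\<close>
    have bq: "b r q = 0" if "r \<noteq> q" for r using rel(2)[OF pq(1) that] pq(2) by simp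
    have "b r s = 0" for r s
    proof -
      have "b r s = 0" if "r \<noteq> q" "s \<noteq> r"
      proof -
        have "a r q \<noteq> 0" using pair[OF that(1)] bq[OF that(1)] by auto
        then show ?thesis using rel(1)[of s r q] that by auto
      qed
      moreover have "b q s = 0" if "s \<noteq> q"
      proof -
        have "a q p \<noteq> 0" using pair[OF pq(1)] bq[OF pq(1)] by auto
        then show ?thesis using rel(1)[of s q p] that pq(1) by auto
      qed
      ultimately show ?thesis using b0 by metis
    qed
    then have b: "b r s = 0" for r s by simp
    have mult: "a p q * a q r = a p r" for p q r
      using rel(3)[of p q r] by (cases "p = q"; cases "r = q") (simp_all add: a1 b)
    have "K A = dg (\<lambda>p. a p o') ** A ** dg (\<lambda>q. a o' q)" for A
    proof -
      have "K A $ p $ q = a p o' * A $ p $ q * a o' q" for p q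
        using mult[of p o' q] by (simp add: K b)
      then show ?thesis by (simp add: vec_eq_iff dg_mult)
    qed
    moreover have "dg (\<lambda>p. a p o') ** dg (\<lambda>q. a o' q) = mat 1"
      by (rule dg_inverse) (simp add: mult a1)
    ultimately show ?thesis using that by blast
  next
    case False
    \<comment> \<open>Dimension one also falls into this case; transposition is trivial
      there.\<close>
    then have a0: "a p q = 0" if "p \<noteq> q" for p q using that by blast
    \<comment> \<open>\<open>b\<close> was set to zero on the diagonal; restoring the ones makes the
      family multiplicative for all indices.\<close>
    define c where "c p q = (if p = q then 1 else b p q)" for p q
    have Kc: "K A $ p $ q = c q p * A $ q $ p" for A p q
      by (cases "p = q") (simp_all add: K c_def a0 a1 b0)
    have mult: "c r q * c q p = c r p" for p q r
      using rel(3)[of p q r] a0[of p q] a0[of p r] by (auto simp: c_def a1 b0 mult.commute)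
    have "K A = dg (\<lambda>p. c o' p) ** transpose A ** dg (\<lambda>q. c q o')" for A
    proof -
      have "K A $ p $ q = c o' p * A $ q $ p * c q o'" for p q
        using mult[of q o' p] by (simp add: Kc mult.commute)
      then show ?thesis by (simp add: vec_eq_iff dg_mult transpose_def)
    qed
    moreover have "dg (\<lambda>p. c o' p) ** dg (\<lambda>q. c q o') = mat 1"
      by (rule dg_inverse) (simp add: mult, simp add: c_def)
    ultimately show ?thesis using that by blast
  qed
qed

text \<open>The images of the E_ii are x_i y_i^T and sum to I, which says that T with columns x_i
  and S with rows y_i satisfy T S = I. Being square they are inverse to each other, and undoing this
  conjugation makes K fix every E_ii.\<close>

lemma rank_one_idempotent_preserver_structure:
  fixes K :: "real ^ 'n ^ 'n \<Rightarrow> real ^ 'n ^ 'n"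
  assumes lin: "linear K" and one: "K (mat 1) = mat 1"
    and rk: "\<And>v f. f \<bullet> v = 1 \<Longrightarrow> \<exists>w g. g \<bullet> w = 1 \<and> K (outer v f) = outer w g"
  obtains T S where "T ** S = mat 1" "(\<forall>A. K A = T ** A ** S) \<or> (\<forall>A. K A = T ** transpose A ** S)"
proof -
  have "\<exists>w g. K (munit i i) = outer w g" for i
    using rk[of "axis i 1" "axis i 1"] by (auto simp: munit_outer inner_axis_axis)
  then obtain x y where xy: "\<And>i. K (munit i i) = outer (x i) (y i)" by metis
  define T where "T = (\<chi> p i. x i $ p)"
  define S where "S = (\<chi> i q. y i $ q)"
  have TES: "T ** munit i i ** S = K (munit i i)" for i
  proof -
    have "T ** munit i i = outer (x i) (axis i 1)"
      by (simp add: munit_outer matrix_outer(1) matrix_vector_mult_basis T_def column_def)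
    moreover have "axis i 1 v* S = y i"
      by (simp add: vec_eq_iff vector_matrix_mult_def S_def axis_def if_distrib[of "\<lambda>x. x * _"] if_distrib[of "\<lambda>x. _ * x"] cong: if_cong)
    ultimately show ?thesis by (simp add: xy matrix_outer(2))
  qed
  have sum1: "(\<Sum>i\<in>UNIV. munit i i) = (mat 1 :: real ^ 'n ^ 'n)"
  proof -
    have "(\<Sum>i\<in>UNIV. munit i i $ p $ q) = (\<Sum>i\<in>UNIV. if i = p then (if p = q then 1 else 0) else 0 :: real)" for p q :: 'n
      by (intro sum.cong) (auto simp: munit_nth)
    then show ?thesis by (simp add: vec_eq_iff mat_def)
  qed
  have "T ** S = (\<Sum>i\<in>UNIV. outer (x i) (y i))"
    by (simp add: vec_eq_iff matrix_matrix_mult_def T_def S_def outer_def)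
  also have "\<dots> = mat 1" using linear_sum[OF lin, of "\<lambda>i. munit i i" UNIV] by (simp add: sum1 one xy)
  finally have TS: "T ** S = mat 1" .
  then have ST: "S ** T = mat 1" by (simp add: matrix_left_right_inverse)
  define K1 where "K1 A = S ** K A ** T" for A
  have K: "K A = T ** K1 A ** S" for A
    unfolding K1_def by (metis TS matrix_mul_assoc matrix_mul_lid matrix_mul_rid)
  have "linear K1"
    by (rule linearI) (simp_all add: K1_def linear_add[OF lin] linear_scale[OF lin] matrix_mult_bilinear)
  moreover have "K1 (munit i i) = munit i i" for i
    unfolding K1_def TES[symmetric] by (metis ST matrix_mul_assoc matrix_mul_lid matrix_mul_rid)
  moreover have "\<exists>w g. g \<bullet> w = 1 \<and> K1 (outer v f) = outer w g" if "f \<bullet> v = 1" for v f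
  proof -
    from rk[OF that] obtain w g where wg: "g \<bullet> w = 1" "K (outer v f) = outer w g" by blast
    have "K1 (outer v f) = outer (S *v w) (g v* T)" by (simp add: K1_def wg(2) matrix_outer)
    moreover have "(g v* T) \<bullet> (S *v w) = 1"
      by (simp add: dot_lmul_matrix matrix_vector_mul_assoc TS wg(1))
    ultimately show ?thesis by blast
  qed
  ultimately obtain T1 S1 where TS1: "T1 ** S1 = mat 1"
    "(\<forall>A. K1 A = T1 ** A ** S1) \<or> (\<forall>A. K1 A = T1 ** transpose A ** S1)"
    using fixes_diagonal_structure[of K1] by metis
  have "(T ** T1) ** (S1 ** S) = mat 1" by (metis TS TS1(1) matrix_mul_assoc matrix_mul_rid)
  moreover have "(\<forall>A. K A = (T ** T1) ** A ** (S1 ** S)) \<or> (\<forall>A. K A = (T ** T1) ** transpose A ** (S1 ** S))"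
    using TS1(2)
  proof
    assume "\<forall>A. K1 A = T1 ** A ** S1"
    then have "\<forall>A. K A = (T ** T1) ** A ** (S1 ** S)" by (simp add: K matrix_mul_assoc)
    then show ?thesis ..
  next
    assume "\<forall>A. K1 A = T1 ** transpose A ** S1"
    then have "\<forall>A. K A = (T ** T1) ** transpose A ** (S1 ** S)" by (simp add: K matrix_mul_assoc)
    then show ?thesis ..
  qed
  ultimately show ?thesis using that by blast
qed

section \<open>Preservers of Schur stability\<close>

lemma schur_stable_eigval: "schur_stable A \<longleftrightarrow> (\<forall>k. eigval A k \<longrightarrow> cmod k < 1)"
  by (simp add: schur_stable_def)

lemma schur_stable_scaled:
  assumes "\<And>k. eigval A k \<Longrightarrow> cmod k < r" "r > 0"
  shows "schur_stable ((1 / r) *\<^sub>R A)"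
  unfolding schur_stable_eigval
proof (intro allI impI)
  fix k assume "eigval ((1 / r) *\<^sub>R A) k"
  then have "eigval A (of_real r * k)"
    using eigval_scale[of "1 / r" A "of_real r * k"] assms(2) by simp
  from assms(1)[OF this] assms(2) show "cmod k < 1" by (simp add: norm_mult)
qed

text \<open>Every matrix is a multiple of a stable one, so L is onto, hence injective, and stability
  passes both ways. If an eigenvalue k exceeded all eigenvalues on the other side in modulus,
  scaling by 1/|k| would separate the two by stability.\<close>

lemma onto_preserver_spectral:
  fixes L :: "real ^ 'n ^ 'n \<Rightarrow> real ^ 'n ^ 'n"
  assumes lin: "linear L" and onto: "onto_preserver_schur L"
  shows "spectral_preserver L"
proof -
  have img: "L ` {A. schur_stable A} = {A. schur_stable A}" using onto by (simp add: onto_preserver_schur_def)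
  have surj: "surj L"
    unfolding surj_def
  proof
    fix B :: "real ^ 'n ^ 'n"
    obtain C where C: "C > 0" "\<And>k. eigval B k \<Longrightarrow> cmod k \<le> C" using eigval_bounded by blast
    have "schur_stable ((1 / (C + 1)) *\<^sub>R B)"
    proof (rule schur_stable_scaled)
      show "cmod k < C + 1" if "eigval B k" for k using C(2)[OF that] by linarith
      show "C + 1 > 0" using C(1) by linarith
    qed
    then have "(1 / (C + 1)) *\<^sub>R B \<in> L ` {A. schur_stable A}" unfolding img by simp
    then obtain A where "L A = (1 / (C + 1)) *\<^sub>R B" by (metis imageE)
    then have "L ((C + 1) *\<^sub>R A) = B" using C(1) by (simp add: linear_scale[OF lin])
    then show "\<exists>A. B = L A" by metis
  qed
  have inj: "inj L" using linear_surjective_imp_injective[OF lin] surj by simp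
  have iff: "schur_stable (L A) \<longleftrightarrow> schur_stable A" for A
  proof
    assume "schur_stable (L A)"
    then have "L A \<in> L ` {A. schur_stable A}" unfolding img by simp
    then show "schur_stable A" using inj by (auto simp: inj_eq)
  next
    assume "schur_stable A"
    then have "L A \<in> L ` {A. schur_stable A}" by simp
    then show "schur_stable (L A)" unfolding img by simp
  qed
  have dom: "\<exists>m. eigval B m \<and> cmod k \<le> cmod m"
    if imp: "\<And>r. schur_stable (r *\<^sub>R B) \<Longrightarrow> schur_stable (r *\<^sub>R B')" and k: "eigval B' k" for B B' k
  proof (rule ccontr)
    assume "\<not> ?thesis"
    then have lt: "cmod m < cmod k" if "eigval B m" for m using that by (meson not_le)
    obtain m where "eigval B m" using eigval_exists[of B] by (elim exE)
    with lt have pos: "cmod k > 0" using norm_ge_zero[of m] by (meson le_less_trans)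
    have "schur_stable ((1 / cmod k) *\<^sub>R B)" using lt pos by (rule schur_stable_scaled)
    then have "schur_stable ((1 / cmod k) *\<^sub>R B')" by (rule imp)
    moreover have "eigval ((1 / cmod k) *\<^sub>R B') (of_real (1 / cmod k) * k)"
      using k eigval_scale[of "1 / cmod k" B' k] pos by simp
    ultimately have "cmod (of_real (1 / cmod k) * k) < 1" unfolding schur_stable_eigval by blast
    with pos show False by (simp add: norm_mult norm_divide)
  qed
  have "schur_stable (r *\<^sub>R A) = schur_stable (r *\<^sub>R L A)" for r A
    using iff[of "r *\<^sub>R A"] by (simp add: linear_scale[OF lin])
  then show ?thesis using lin surj dom by (intro spectral_preserver.intro) blast+
qed

lemma inner_transpose: "A \<bullet> transpose B = transpose A \<bullet> (B :: real ^ 'n ^ 'n)"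
proof -
  have "A \<bullet> transpose B = (\<Sum>i\<in>UNIV. \<Sum>j\<in>UNIV. A $ i $ j * B $ j $ i)"
    by (simp add: inner_vec_def transpose_def)
  also have "\<dots> = (\<Sum>j\<in>UNIV. \<Sum>i\<in>UNIV. A $ i $ j * B $ j $ i)" by (rule sum.swap)
  finally show ?thesis by (simp add: inner_vec_def transpose_def)
qed

context unital_spectral_preserver
begin

lemma conjugation_form:
  obtains T S where "T ** S = mat 1" "(\<forall>A. L A = T ** A ** S) \<or> (\<forall>A. L A = T ** transpose A ** S)"
proof -
  let ?M = "adjoint L"
  have linM: "linear ?M" by (rule adjoint_linear[OF lin])
  have adj: "L A \<bullet> B = A \<bullet> ?M B" for A B using adjoint_works[OF lin, of A B] by simp
  have "inj ?M"
    unfolding linear_injective_0[OF linM]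
  proof (intro allI impI)
    fix B assume "?M B = 0"
    then have "L A \<bullet> B = 0" for A by (simp add: adj)
    moreover obtain A where "B = L A" using surjD[OF onto] by blast
    ultimately show "B = 0" by (metis inner_eq_zero_iff)
  qed
  then obtain K where K: "linear K" "K \<circ> ?M = id" "?M \<circ> K = id"
    using linear_injective_isomorphism[OF linM] by (metis comp_def eq_id_iff)
  have KM: "K (?M B) = B" "?M (K B) = B" for B using K(2,3) by (metis comp_apply id_apply)+
  \<comment> \<open>This is what makes K the inverse adjoint; it lets the trace identity for images
    of idempotents determine K on them.\<close>
  have LK: "L A \<bullet> K B = A \<bullet> B" for A B by (simp add: adj KM)
  have "K (mat 1) = mat 1" using KM(1)[of "mat 1"] by (simp add: adjoint_one)
  moreover have "\<exists>w g. g \<bullet> w = 1 \<and> K (outer v f) = outer w g" if "f \<bullet> v = 1" for v f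
  proof -
    \<comment> \<open>The inner product is tr (A^t B), while the trace identity concerns tr (A B);
      the transposition exchanges v and f.\<close>
    have "v \<bullet> f = 1" using that by (simp add: inner_commute)
    then obtain w g where wg: "g \<bullet> w = 1" "\<And>A. trace (L A ** outer w g) = trace (A ** outer f v)"
      using image_rank_one_idempotent by blast
    have tr: "A \<bullet> outer a b = trace (A ** outer b a)" for A :: "real ^ 'n ^ 'n" and a b
      by (metis inner_commute inner_matrix_trace trace_mul_sym transpose_outer)
    have "B \<bullet> (K (outer v f) - outer g w) = 0" for B
    proof -
      obtain A where "B = L A" using surjD[OF onto] by blast
      then show ?thesis by (simp add: inner_diff_right LK tr wg(2))
    qed
    then have "K (outer v f) = outer g w" by (metis eq_iff_diff_eq_0 inner_eq_zero_iff)
    with wg(1) show ?thesis by (metis inner_commute)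
  qed
  ultimately obtain T S where TS: "T ** S = mat 1" and
    form: "(\<forall>A. K A = T ** A ** S) \<or> (\<forall>A. K A = T ** transpose A ** S)"
    using rank_one_idempotent_preserver_structure[OF K(1)] by metis
  have ST: "S ** T = mat 1" using TS by (simp add: matrix_left_right_inverse)
  define P where "P = transpose S"
  define Q where "Q = transpose T"
  have PQ: "P ** Q = mat 1" "Q ** P = mat 1"
    using TS ST by (simp_all add: P_def Q_def flip: matrix_transpose_mul)
  \<comment> \<open>The adjoint of a conjugation is the conjugation by the transposes, so the form
    of K passes back to L.\<close>
  have move: "X \<bullet> (T ** Y ** S) = (Q ** X ** P) \<bullet> Y" for X Y :: "real ^ 'n ^ 'n"
  proof -
    have "X \<bullet> (T ** Y ** S) = trace ((transpose X ** T ** Y) ** S)"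
      by (simp add: inner_matrix_trace matrix_mul_assoc)
    also have "\<dots> = trace (S ** (transpose X ** T ** Y))" by (rule trace_mul_sym)
    also have "\<dots> = (Q ** X ** P) \<bullet> Y"
      by (simp add: inner_matrix_trace matrix_transpose_mul P_def Q_def matrix_mul_assoc)
    finally show ?thesis .
  qed
  have undo: "X = P ** Y ** Q" if "Q ** X ** P = Y" for X Y
    using that PQ by (metis matrix_mul_assoc matrix_mul_lid matrix_mul_rid)
  have eqI: "X = Y" if "\<And>B. X \<bullet> B = Y \<bullet> B" for X Y :: "real ^ 'n ^ 'n"
    using that[of "X - Y"] by (metis eq_iff_diff_eq_0 inner_diff_left inner_eq_zero_iff)
  from form show ?thesis
  proof
    assume "\<forall>A. K A = T ** A ** S"
    then have "Q ** L A ** P = A" for A using LK by (intro eqI) (simp flip: move)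
    then show ?thesis using undo that[OF PQ(1)] by blast
  next
    assume f: "\<forall>A. K A = T ** transpose A ** S"
    have "Q ** L A ** P = transpose A" for A
    proof (rule eqI)
      fix B
      have "(Q ** L A ** P) \<bullet> B = L A \<bullet> K (transpose B)" by (simp add: f move)
      also have "\<dots> = A \<bullet> transpose B" by (rule LK)
      also have "\<dots> = transpose A \<bullet> B"
        by (rule inner_transpose)
      finally show "(Q ** L A ** P) \<bullet> B = transpose A \<bullet> B" .
    qed
    then show ?thesis using undo that[OF PQ(1)] by blast
  qed
qed

end

lemma spectral_preserver_uminus:
  fixes L :: "real ^ 'n ^ 'n \<Rightarrow> real ^ 'n ^ 'n"
  assumes "spectral_preserver L"
  shows "spectral_preserver (\<lambda>A. - L A)"
proof -
  interpret spectral_preserver L by fact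
  have neg: "eigval (- A) k \<longleftrightarrow> eigval A (- k)" for A :: "real ^ 'n ^ 'n" and k
    using eigval_scale[of "- 1" A "- k"] by simp
  show ?thesis
  proof (rule spectral_preserver.intro)
    show "linear (\<lambda>A. - L A)" by (rule linear_compose_neg[OF lin])
    show "surj (\<lambda>A. - L A)" using onto by (metis surj_def minus_minus)
    show "\<exists>m. eigval A m \<and> cmod k \<le> cmod m" if "eigval (- L A) k" for A k
      using dom[of A "- k"] that neg by auto
    show "\<exists>m. eigval (- L A) m \<and> cmod k \<le> cmod m" if "eigval A k" for A k
    proof -
      from dom'[OF that] obtain m where "eigval (L A) m" "cmod k \<le> cmod m" by blast
      then show ?thesis using neg[of "L A" "- m"] by (intro exI[of _ "- m"]) simp
    qed
  qed
qed

lemma onto_preserver_schurI: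
  fixes L :: "real ^ 'n ^ 'n \<Rightarrow> real ^ 'n ^ 'n"
  assumes T: "T ** S = mat 1" "S ** T = mat 1" and c: "\<bar>c\<bar> = 1"
    and L: "(\<forall>A. L A = c *\<^sub>R (T ** A ** S)) \<or> (\<forall>A. L A = c *\<^sub>R (T ** transpose A ** S))"
  shows "onto_preserver_schur L"
proof -
  have c0: "c \<noteq> 0" and cc: "c * c = 1" using c by (auto simp: abs_if split: if_splits)
  have sc: "schur_stable (c *\<^sub>R A) \<longleftrightarrow> schur_stable A" for A :: "real ^ 'n ^ 'n"
  proof -
    have "schur_stable (c *\<^sub>R A)" if "schur_stable A" for A :: "real ^ 'n ^ 'n"
      unfolding schur_stable_eigval
    proof (intro allI impI)
      fix k assume k: "eigval (c *\<^sub>R A) k"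
      have "of_real c * (of_real c * k) = k" using cc by (metis mult.assoc mult_1 of_real_1 of_real_mult)
      with k have "eigval (c *\<^sub>R A) (of_real c * (of_real c * k))" by (simp only:)
      then have "eigval A (of_real c * k)" by (simp only: eigval_scale[OF c0])
      with that have "cmod (of_real c * k) < 1" unfolding schur_stable_eigval by blast
      then show "cmod k < 1" using c by (simp add: norm_mult)
    qed
    from this[of A] this[of "c *\<^sub>R A"] show ?thesis using cc by auto
  qed
  have sim: "schur_stable (T ** A ** S) \<longleftrightarrow> schur_stable A" for A
  proof -
    have "cmat T ** cmat S = mat 1" "cmat S ** cmat T = mat 1" by (simp_all add: T cmat_one flip: cmat_mult)
    from mat_eigenvalue_similar[OF this] show ?thesis by (simp add: schur_stable_eigval cmat_mult)
  qed
  have tr: "schur_stable (transpose A) \<longleftrightarrow> schur_stable A" for A :: "real ^ 'n ^ 'n"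
    by (simp add: schur_stable_eigval cmat_transpose mat_eigenvalue_transpose)
  have iff: "schur_stable (L A) \<longleftrightarrow> schur_stable A" for A using L sc sim tr by metis
  have conj: "T ** (S ** B ** T) ** S = B" for B by (metis T(1) matrix_mul_assoc matrix_mul_lid matrix_mul_rid)
  have "\<exists>A. L A = B" for B
    using L
  proof
    assume "\<forall>A. L A = c *\<^sub>R (T ** A ** S)"
    then have "L (S ** (c *\<^sub>R B) ** T) = B" by (simp only: conj) (simp add: cc)
    then show ?thesis ..
  next
    assume "\<forall>A. L A = c *\<^sub>R (T ** transpose A ** S)"
    then have "L (transpose (S ** (c *\<^sub>R B) ** T)) = B" by (simp only: transpose_transpose conj) (simp add: cc)
    then show ?thesis ..
  qed
  with iff show ?thesis unfolding onto_preserver_schur_def by (auto simp: image_iff) metis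
qed

lemma matrix_inv_inverse:
  assumes "invertible T"
  shows "T ** matrix_inv T = mat 1" "matrix_inv T ** T = mat 1"
  using someI_ex[OF assms[unfolded invertible_def]] by (simp_all add: matrix_inv_def)

theorem mainTheorem5:
  fixes L :: "real ^ 'n ^ 'n \<Rightarrow> real ^ 'n ^ 'n"
  assumes "linear L"
  shows "onto_preserver_schur L \<longleftrightarrow>
    (\<exists>(T :: real ^ 'n ^ 'n) (c :: real). invertible T \<and> \<bar>c\<bar> = 1 \<and>
      ((\<forall>A. L A = c *\<^sub>R (T ** A ** matrix_inv T)) \<or>
       (\<forall>A. L A = c *\<^sub>R (T ** transpose A ** matrix_inv T))))"
proof
  assume "onto_preserver_schur L"
  with assms have sp: "spectral_preserver L" by (rule onto_preserver_spectral)
  then obtain c where c: "\<bar>c\<bar> = 1" "L (mat 1) = c *\<^sub>R mat 1" by (rule spectral_preserver.image_one)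
  have cc: "c * c = 1" using c(1) by (auto simp: abs_if split: if_splits)
  \<comment> \<open>As c is 1 or -1, multiplying L by c makes it unital without changing any
    modulus.\<close>
  have "spectral_preserver (\<lambda>A. c *\<^sub>R L A)"
  proof (cases "c = 1")
    case True
    then show ?thesis using sp by simp
  next
    case False
    then have "c = - 1" using c(1) by linarith
    then show ?thesis using spectral_preserver_uminus[OF sp] by simp
  qed
  then interpret u: unital_spectral_preserver "\<lambda>A. c *\<^sub>R L A"
    by (rule unital_spectral_preserver.intro) (unfold_locales, simp add: c(2) cc)
  obtain T S where TS: "T ** S = mat 1"
    "(\<forall>A. c *\<^sub>R L A = T ** A ** S) \<or> (\<forall>A. c *\<^sub>R L A = T ** transpose A ** S)" by (rule u.conjugation_form)
  have ST: "S ** T = mat 1" using TS(1) by (simp add: matrix_left_right_inverse)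
  have inv: "invertible T" using TS(1) ST by (auto simp: invertible_def)
  have S: "matrix_inv T = S"
    by (metis ST matrix_inv_inverse(1)[OF inv] matrix_mul_assoc matrix_mul_lid matrix_mul_rid)
  have "L A = c *\<^sub>R (c *\<^sub>R L A)" for A by (simp add: cc)
  with TS(2) have "(\<forall>A. L A = c *\<^sub>R (T ** A ** S)) \<or> (\<forall>A. L A = c *\<^sub>R (T ** transpose A ** S))"
    by metis
  with inv c(1) S show "\<exists>T c. invertible T \<and> \<bar>c\<bar> = 1 \<and>
      ((\<forall>A. L A = c *\<^sub>R (T ** A ** matrix_inv T)) \<or>
       (\<forall>A. L A = c *\<^sub>R (T ** transpose A ** matrix_inv T)))" by metis
next
  assume "\<exists>(T :: real ^ 'n ^ 'n) (c :: real). invertible T \<and> \<bar>c\<bar> = 1 \<and>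
      ((\<forall>A. L A = c *\<^sub>R (T ** A ** matrix_inv T)) \<or>
       (\<forall>A. L A = c *\<^sub>R (T ** transpose A ** matrix_inv T)))"
  then obtain T :: "real ^ 'n ^ 'n" and c where "invertible T" "\<bar>c\<bar> = 1"
    "(\<forall>A. L A = c *\<^sub>R (T ** A ** matrix_inv T)) \<or> (\<forall>A. L A = c *\<^sub>R (T ** transpose A ** matrix_inv T))"
    by blast
  then show "onto_preserver_schur L"
    by (intro onto_preserver_schurI[of T "matrix_inv T" c]) (auto simp: matrix_inv_inverse)
qed

end
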